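(* For $n\ge 3$, let $f(n)$ denote the mean of the squared linking number $\ell(P\cup Q)^2$ taken over all unordered pairs $\{P,Q\}$ of disjoint (unoriented) monotonic $n$-cycles in $K_{2n}$ (each pair weighted equally) and over all random book embeddings of $K_{2n}$. Then $f(n)$ is in order $\theta(n)$, i.e. there are positive constants $a$, $A$ and $N$ such that $an\le f(n)\le An$ for all $n>N$.
   Context: Circular diagram. For $N\ge 4$, the vertices $v_1,\dots,v_N$ of the complete graph $K_N$ are placed at $N$ distinct points of a circle in clockwise order. Edges joining consecutive vertices $v_j,v_{j+1}$ (indices mod $N$) are called exterior edges and are drawn as arcs of the circle. The remaining $\binom{N}{2}-N$ edges are called interior edges and are projected to straight chords. Random book embedding. Each interior edge is placed on its own sheet (a disc bounded by the circle). The height order of the sheets is given by a uniformly random permutation $\sigma$ of $\{1,\dots,\binom N2-N\}$: interior edge $e_a$ lies above interior edge $e_b$ iff $\sigma(a)>\sigma(b)$. This determines an embedding of $K_N$ in $\mathbb{R}^3$ up to equivalence. Probabilities, proportions and means are with respect to $\sigma$. Monotonic cycles. Cycles are simple cycles of length at least $3$. An oriented cycle with consecutive edges $\overrightarrow{v_{i_1}v_{i_2}},\dots,\overrightarrow{v_{i_{k-1}}v_{i_k}},\overrightarrow{v_{i_k}v_{i_1}}$ is strictly increasing (resp. strictly decreasing) if some cyclic permutation $i_1',\dots,i_k'$ of $i_1,\dots,i_k$ satisfies $i_j'<i_{j+1}'$ (resp. $i_j'>i_{j+1}'$) for all $1\le j\le k-1$. It is monotonic if it is strictly increasing or strictly decreasing.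 An unoriented cycle is monotonic if it is so for some (equivalently any) orientation. Two cycles are disjoint if they share no vertex. Linking number. For disjoint oriented cycles $P,Q$ and a given embedding, $\ell(P\cup Q)$ is half the sum of the signs of the crossings, in the circular diagram, between an edge of $P$ and an edge of $Q$ (two chords cross when they meet in their interiors; only interior edges can cross). A crossing has sign $+1$ if (direction of the over-edge, direction of the under-edge) is a positively oriented basis of the plane, and $-1$ otherwise. Reversing the orientation of one cycle changes the sign of $\ell(P\cup Q)$, so $\ell(P\cup Q)^2$ does not depend on orientations. *)

theory Defs
  imports "HOL-Probability.Probability" "HOL-Combinatorics.Permutations"
begin

(* The vertex v_j is represented by its index j in {1..N}, an edge by the set of its endpoints. *)

definition complete_edges :: "nat \<Rightarrow> nat set set" where
  "complete_edges N = {{i, j} | i j. i \<in> {1..N} \<and> j \<in> {1..N} \<and> i \<noteq> j}"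

definition exterior_edges :: "nat \<Rightarrow> nat set set" where
  "exterior_edges N = {{j, j mod N + 1} | j. j \<in> {1..N}}"

definition interior_edges :: "nat \<Rightarrow> nat set set" where
  "interior_edges N = complete_edges N - exterior_edges N"

definition num_interior :: "nat \<Rightarrow> nat" where
  "num_interior N = (N choose 2) - N"

definition clockwise_on_circle :: "nat \<Rightarrow> (nat \<Rightarrow> complex) \<Rightarrow> bool" where
  "clockwise_on_circle N p \<longleftrightarrow>
     (\<exists>c r \<theta>. r > 0 \<and> strict_mono_on {1..N} \<theta> \<and> \<theta> N < \<theta> 1 + 2 * pi \<and>
        (\<forall>j\<in>{1..N}. p j = c + of_real r * cis (- \<theta> j)))"

definition interior_enumeration :: "nat \<Rightarrow> (nat \<Rightarrow> nat set) \<Rightarrow> bool" where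
  "interior_enumeration N e \<longleftrightarrow> bij_betw e {1..num_interior N} (interior_edges N)"

definition above :: "nat \<Rightarrow> (nat \<Rightarrow> nat set) \<Rightarrow> (nat \<Rightarrow> nat) \<Rightarrow> nat set \<Rightarrow> nat set \<Rightarrow> bool" where
  "above N e \<sigma> x y \<longleftrightarrow>
     (\<exists>a\<in>{1..num_interior N}. \<exists>b\<in>{1..num_interior N}. x = e a \<and> y = e b \<and> \<sigma> a > \<sigma> b)"

(* An oriented cycle is given by the list of its vertices in the order in which they are
   traversed; the same oriented cycle is given by all rotations of the list. *)

definition oriented_cycle :: "nat \<Rightarrow> nat list \<Rightarrow> bool" where
  "oriented_cycle N vs \<longleftrightarrow> distinct vs \<and> length vs \<ge> 3 \<and> set vs \<subseteq> {1..N}"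

definition directed_edges :: "nat list \<Rightarrow> (nat \<times> nat) set" where
  "directed_edges vs = {(vs ! i, vs ! (Suc i mod length vs)) | i. i < length vs}"

definition end_points :: "nat \<times> nat \<Rightarrow> nat set" where
  "end_points d = {fst d, snd d}"

(* An unoriented cycle is identified with its set of edges. *)

definition unoriented :: "nat list \<Rightarrow> nat set set" where
  "unoriented vs = end_points ` directed_edges vs"

definition strictly_increasing :: "nat list \<Rightarrow> bool" where
  "strictly_increasing vs \<longleftrightarrow> (\<exists>m. sorted_wrt (<) (rotate m vs))"

definition strictly_decreasing :: "nat list \<Rightarrow> bool" where
  "strictly_decreasing vs \<longleftrightarrow> (\<exists>m. sorted_wrt (>) (rotate m vs))"

definition monotonic :: "nat list \<Rightarrow> bool" where
  "monotonic vs \<longleftrightarrow> strictly_increasing vs \<or> strictly_decreasing vs"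

definition monotonic_cycles :: "nat \<Rightarrow> nat \<Rightarrow> nat set set set" where
  "monotonic_cycles N k =
     {unoriented vs | vs. oriented_cycle N vs \<and> length vs = k \<and> monotonic vs}"

definition disjoint_monotonic_pairs :: "nat \<Rightarrow> nat \<Rightarrow> nat set set set set" where
  "disjoint_monotonic_pairs N k =
     {{P, Q} | P Q. P \<in> monotonic_cycles N k \<and> Q \<in> monotonic_cycles N k \<and> \<Union>P \<inter> \<Union>Q = {}}"

definition crossing :: "nat \<Rightarrow> (nat \<Rightarrow> complex) \<Rightarrow> nat \<times> nat \<Rightarrow> nat \<times> nat \<Rightarrow> bool" where
  "crossing N p d d' \<longleftrightarrow>
     end_points d \<in> interior_edges N \<and> end_points d' \<in> interior_edges N \<and>
     open_segment (p (fst d)) (p (snd d)) \<inter> open_segment (p (fst d')) (p (snd d')) \<noteq> {}"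

definition direction :: "(nat \<Rightarrow> complex) \<Rightarrow> nat \<times> nat \<Rightarrow> complex" where
  "direction p d = p (snd d) - p (fst d)"

(* positive determinant of the matrix with columns z and w *)

definition positively_oriented :: "complex \<Rightarrow> complex \<Rightarrow> bool" where
  "positively_oriented z w \<longleftrightarrow> Re z * Im w - Im z * Re w > 0"

definition crossing_sign ::
  "nat \<Rightarrow> (nat \<Rightarrow> complex) \<Rightarrow> (nat \<Rightarrow> nat set) \<Rightarrow> (nat \<Rightarrow> nat) \<Rightarrow> nat \<times> nat \<Rightarrow> nat \<times> nat \<Rightarrow> real" where
  "crossing_sign N p e \<sigma> d d' =
     (let (over, under) = (if above N e \<sigma> (end_points d) (end_points d') then (d, d') else (d', d))
      in if positively_oriented (direction p over) (direction p under) then 1 else - 1)"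

definition linking_number ::
  "nat \<Rightarrow> (nat \<Rightarrow> complex) \<Rightarrow> (nat \<Rightarrow> nat set) \<Rightarrow> (nat \<Rightarrow> nat) \<Rightarrow> nat list \<Rightarrow> nat list \<Rightarrow> real" where
  "linking_number N p e \<sigma> vs ws =
     (\<Sum>(d, d') \<in> {(d, d') \<in> directed_edges vs \<times> directed_edges ws. crossing N p d d'}.
        crossing_sign N p e \<sigma> d d') / 2"

(* The squared linking number of an unordered pair of disjoint unoriented cycles is that of an
   arbitrary choice of orientations; it does not depend on the choice. *)

definition sq_linking ::
  "nat \<Rightarrow> (nat \<Rightarrow> complex) \<Rightarrow> (nat \<Rightarrow> nat set) \<Rightarrow> (nat \<Rightarrow> nat) \<Rightarrow> nat set set set \<Rightarrow> real" where
  "sq_linking N p e \<sigma> S =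
     (SOME x. \<exists>vs ws. oriented_cycle N vs \<and> oriented_cycle N ws \<and>
        S = {unoriented vs, unoriented ws} \<and> x = (linking_number N p e \<sigma> vs ws)\<^sup>2)"

definition random_permutation :: "nat \<Rightarrow> (nat \<Rightarrow> nat) pmf" where
  "random_permutation M = pmf_of_set {\<sigma>. \<sigma> permutes {1..M}}"

definition mean_sq_linking :: "nat \<Rightarrow> (nat \<Rightarrow> complex) \<Rightarrow> (nat \<Rightarrow> nat set) \<Rightarrow> real" where
  "mean_sq_linking n p e =
     measure_pmf.expectation
       (pair_pmf (pmf_of_set (disjoint_monotonic_pairs (2 * n) n))
                 (random_permutation (num_interior (2 * n))))
       (\<lambda>(S, \<sigma>). sq_linking (2 * n) p e \<sigma> S)"

end

theory Submission imports Defs begin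

text \<open>
  Two disjoint monotonic \<open>n\<close>-cycles in \<open>K\<^sub>2\<^sub>n\<close> are convex polygons on complementary sets of \<open>n\<close>
  vertices. Orient both in increasing order. An edge of one polygon cuts off an arc that contains no
  vertex of its own cycle, and the other polygon enters and leaves this arc at most once. Hence every
  edge is involved in at most two crossings (\<open>card_edges_crossing_arc_le_2\<close>), and there are
  at most \<open>2n\<close> crossings.

  Fix the pair. The sign of a crossing is a constant \<open>\<plusminus>1\<close> times the comparison of two random
  heights. Signs of crossings without a common edge are uncorrelated, and for two crossings with a
  common edge the correlation is \<open>\<plusminus>1/3\<close>. As a crossing shares an edge with at most two others, it
  contributes to the mean of the squared sum of signs an amount between \<open>1 - 2/3\<close> and
  \<open>1 + 2/3\<close>: however the constant signs are distributed, correlations cannot cancel the diagonal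
  (\<open>second_moment_comparisons\<close>). So the mean of the squared linking number over the heights lies
  between \<open>1/12\<close> and \<open>5/12\<close> of the number of crossings (\<open>second_moment_linking_number\<close>).

  This gives the upper bound at once. For the lower bound the mean number of crossings over all
  pairs has to grow linearly. Whenever four consecutive vertices alternate between
  the two cycles, there is a crossing of the chords that join the first to the third and the second to
  the fourth; for every position this happens for at least one pair in sixteen
  (\<open>sum_card_alternations\<close>).
\<close>

section \<open>Crossing chords of a circle\<close>

text \<open>The vertices of the circle that one meets strictly between \<open>a\<close> and \<open>b\<close> when walking
clockwise from \<open>a\<close>. In the second branch the walk passes the point where the labels restart;
for \<open>a = b\<close> it is a full turn.\<close>

definition cyclic_between :: "nat \<Rightarrow> nat \<Rightarrow> nat \<Rightarrow> bool" where
  "cyclic_between a b z \<longleftrightarrow> (if a < b then a < z \<and> z < b else a < z \<or> z < b)"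

text \<open>The determinant of the matrix with columns \<open>z\<close>, \<open>w\<close>; its sign decides on which side of a
line a point lies and whether two directions form a positively oriented basis.\<close>

definition cross :: "complex \<Rightarrow> complex \<Rightarrow> real" where
  "cross z w = Re z * Im w - Im z * Re w"

lemma cross_commute: "cross w z = - cross z w"
  by (simp add: cross_def algebra_simps)

text \<open>Twice the area of the triangle on the unit circle whose arcs are \<open>2u\<close>, \<open>2v\<close> and the rest is
the left-hand side; the product form shows that it is positive as soon as
\<open>u\<close>, \<open>v\<close> and \<open>u + v\<close> lie strictly between \<open>0\<close> and \<open>\<pi>\<close>.\<close>

lemma sin_sum_product:
  "sin (2 * u) + sin (2 * v) - sin (2 * u + 2 * v) = 4 * sin u * sin v * sin (u + v)" for u v :: real
proof -
  have "sin (2 * u) + sin (2 * v) = 2 * sin (u + v) * cos (u - v)"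
    by (simp add: sin_plus_sin add_divide_distrib diff_divide_distrib)
  moreover have "sin (2 * u + 2 * v) = 2 * sin (u + v) * cos (u + v)"
    using sin_double[of "u + v"] by (simp add: distrib_left)
  ultimately show ?thesis
    by (simp add: cos_add cos_diff algebra_simps)
qed

lemma clockwise_triangle:
  assumes "clockwise_on_circle N p" "i \<in> {1..N}" "k \<in> {1..N}" "i < j" "j < k"
  shows "cross (p j - p i) (p k - p i) < 0"
proof -
  obtain c r \<theta> where r: "r > 0" and mono: "strict_mono_on {1..N} \<theta>" and wrap: "\<theta> N < \<theta> 1 + 2 * pi"
    and p: "\<And>j. j \<in> {1..N} \<Longrightarrow> p j = c + of_real r * cis (- \<theta> j)"
    using assms(1) unfolding clockwise_on_circle_def by blast
  have j: "j \<in> {1..N}" using assms by auto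
  define u where "u = (\<theta> j - \<theta> i) / 2"
  define v where "v = (\<theta> k - \<theta> j) / 2"
  have "\<theta> i < \<theta> j" "\<theta> j < \<theta> k"
    using mono assms j by (auto simp: strict_mono_on_def)
  moreover have "\<theta> 1 \<le> \<theta> i" "\<theta> k \<le> \<theta> N"
    using strict_mono_on_imp_mono_on[OF mono] assms by (auto intro!: mono_onD[of "{1..N}" \<theta>])
  ultimately have "0 < u" "0 < v" "u + v < pi"
    using wrap by (auto simp: u_def v_def field_simps)
  then have pos: "sin u > 0" "sin v > 0" "sin (u + v) > 0"
    by (auto intro!: sin_gt_zero)
  have "cross (p j - p i) (p k - p i) = r\<^sup>2 * (sin (\<theta> j - \<theta> k) - sin (\<theta> j - \<theta> i) - sin (\<theta> i - \<theta> k))"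
    by (simp add: p[OF assms(2)] p[OF assms(3)] p[OF j] cross_def sin_diff power2_eq_square algebra_simps)
  also have "sin (\<theta> j - \<theta> k) - sin (\<theta> j - \<theta> i) - sin (\<theta> i - \<theta> k)
      = - (sin (2 * u) + sin (2 * v) - sin (2 * u + 2 * v))"
  proof -
    have "\<theta> j - \<theta> k = - (2 * v)" "\<theta> j - \<theta> i = 2 * u" "\<theta> i - \<theta> k = - (2 * u + 2 * v)"
      by (simp_all add: u_def v_def field_simps)
    then show ?thesis by (simp only: sin_minus)
  qed
  also have "r\<^sup>2 * - (sin (2 * u) + sin (2 * v) - sin (2 * u + 2 * v)) < 0"
    unfolding sin_sum_product using pos r by (simp add: mult_pos_pos)
  finally show ?thesis .
qed

text \<open>The line through \<open>a\<close> and \<open>b\<close> cuts the circle into the two arcs between them, so the side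
on which a third vertex lies is a matter of cyclic order. Each of the six orders of three labels
reduces to \<open>clockwise_triangle\<close>, because a cyclic shift preserves the determinant and
a transposition negates it.\<close>

lemma clockwise_side:
  assumes "clockwise_on_circle N p" "a \<in> {1..N}" "b \<in> {1..N}" "z \<in> {1..N}" "a \<noteq> b" "z \<noteq> a" "z \<noteq> b"
  shows "cyclic_between a b z \<Longrightarrow> cross (p b - p a) (p z - p a) > 0"
    and "\<not> cyclic_between a b z \<Longrightarrow> cross (p b - p a) (p z - p a) < 0"
proof -
  note tri = clockwise_triangle[OF assms(1)]
  have rot: "cross (p b - p a) (p z - p a) = cross (p z - p b) (p a - p b)"
            "cross (p b - p a) (p z - p a) = cross (p a - p z) (p b - p z)"
    by (simp_all add: cross_def algebra_simps)
  have swap: "cross (p b - p a) (p z - p a) = - cross (p z - p a) (p b - p a)"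
             "cross (p b - p a) (p z - p a) = - cross (p a - p b) (p z - p b)"
             "cross (p b - p a) (p z - p a) = - cross (p b - p z) (p a - p z)"
    by (simp_all add: cross_def algebra_simps)
  consider "a < b" "b < z" | "b < z" "z < a" | "z < a" "a < b"
    | "a < z" "z < b" | "b < a" "a < z" | "z < b" "b < a"
    using assms by linarith
  then have "(cyclic_between a b z \<longrightarrow> cross (p b - p a) (p z - p a) > 0) \<and>
      (\<not> cyclic_between a b z \<longrightarrow> cross (p b - p a) (p z - p a) < 0)"
  proof cases
    case 1 then show ?thesis using tri[of a z b] assms by (auto simp: cyclic_between_def)
  next
    case 2 then show ?thesis using tri[of b a z] assms rot by (auto simp: cyclic_between_def)
  next
    case 3 then show ?thesis using tri[of z b a] assms rot by (auto simp: cyclic_between_def)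
  next
    case 4 then show ?thesis using tri[of a b z] assms swap by (auto simp: cyclic_between_def)
  next
    case 5 then show ?thesis using tri[of b z a] assms swap by (auto simp: cyclic_between_def)
  next
    case 6 then show ?thesis using tri[of z a b] assms swap by (auto simp: cyclic_between_def)
  qed
  then show "cyclic_between a b z \<Longrightarrow> cross (p b - p a) (p z - p a) > 0"
    and "\<not> cyclic_between a b z \<Longrightarrow> cross (p b - p a) (p z - p a) < 0" by blast+
qed

lemma cross_affine:
  "cross w ((1 - t) *\<^sub>R x + t *\<^sub>R y - a) = (1 - t) * cross w (x - a) + t * cross w (y - a)"
  by (simp add: cross_def algebra_simps)

lemma open_segments_disjoint:
  assumes "cross (b - a) (c - a) * cross (b - a) (d - a) > 0"
  shows "open_segment a b \<inter> open_segment c d = {}"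
proof (rule ccontr)
  assume "open_segment a b \<inter> open_segment c d \<noteq> {}"
  then obtain s t where t: "0 < t" "t < 1"
    and eq: "(1 - s) *\<^sub>R a + s *\<^sub>R b = (1 - t) *\<^sub>R c + t *\<^sub>R d"
    by (auto simp: in_segment)
  have "cross (b - a) ((1 - s) *\<^sub>R a + s *\<^sub>R b - a) = 0"
    unfolding cross_affine by (simp add: cross_def)
  then have zero: "(1 - t) * cross (b - a) (c - a) + t * cross (b - a) (d - a) = 0"
    unfolding eq cross_affine .
  consider "cross (b - a) (c - a) > 0" "cross (b - a) (d - a) > 0"
    | "cross (b - a) (c - a) < 0" "cross (b - a) (d - a) < 0"
    using assms by (auto simp: zero_less_mult_iff)
  then show False
  proof cases
    case 1
    then have "(1 - t) * cross (b - a) (c - a) > 0" "t * cross (b - a) (d - a) > 0"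
      using t by simp_all
    then show False using zero by linarith
  next
    case 2
    then have "(1 - t) * cross (b - a) (c - a) < 0" "t * cross (b - a) (d - a) < 0"
      using t by (simp_all add: mult_less_0_iff)
    then show False using zero by linarith
  qed
qed

text \<open>If \<open>c\<close>, \<open>d\<close> are separated by the line \<open>ab\<close> and \<open>a\<close>, \<open>b\<close> by the line \<open>cd\<close>, the
intersection point of the two lines divides both segments in the ratios of the
determinants that measure the distances of the end points from the other line.\<close>

lemma open_segments_meet:
  assumes "cross (b - a) (c - a) * cross (b - a) (d - a) < 0"
    and "cross (d - c) (a - c) * cross (d - c) (b - c) < 0"
  shows "open_segment a b \<inter> open_segment c d \<noteq> {}"
proof -
  have ratio: "x / (x - y) > 0 \<and> x / (x - y) < 1" if "x * y < 0" for x y :: real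
  proof (cases "x > 0")
    case True then have "y < 0" using that by (auto simp: mult_less_0_iff)
    then show ?thesis using True by (auto simp: field_simps)
  next
    case False then have "x < 0" "y > 0" using that by (auto simp: mult_less_0_iff)
    then show ?thesis by (auto simp: field_simps)
  qed
  define x where "x = cross (b - a) (c - a)"
  define y where "y = cross (b - a) (d - a)"
  define x' where "x' = cross (d - c) (a - c)"
  define y' where "y' = cross (d - c) (b - c)"
  note defs = x_def y_def x'_def y'_def
  have ne: "x - y \<noteq> 0" using assms(1) unfolding defs[symmetric] by (smt (verit) zero_le_square)
  have neg: "x' - y' = - (x - y)" by (simp add: defs cross_def algebra_simps)
  \<comment> \<open>Both expressions of the intersection point, with the common denominator cleared.\<close>
  have "(x' - y') *\<^sub>R a + x' *\<^sub>R (b - a) = - ((x - y) *\<^sub>R c + x *\<^sub>R (d - c))"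
    by (rule complex_eqI) (simp_all add: defs cross_def algebra_simps)
  then have key: "(x - y) *\<^sub>R a - x' *\<^sub>R (b - a) = (x - y) *\<^sub>R c + x *\<^sub>R (d - c)"
    unfolding neg by (simp add: algebra_simps)
  define s where "s = x / (x - y)"
  define s' where "s' = x' / (x' - y')"
  have "(x - y) * s = x" using ne by (simp add: s_def)
  moreover have "(x' - y') * s' = x'" using ne neg by (simp add: s'_def)
  then have "(x - y) * s' = - x'" unfolding neg by (simp add: algebra_simps)
  ultimately have "(x - y) *\<^sub>R (a + s' *\<^sub>R (b - a)) = (x - y) *\<^sub>R (c + s *\<^sub>R (d - c))"
    using key by (simp add: scaleR_add_right)
  then have "a + s' *\<^sub>R (b - a) = c + s *\<^sub>R (d - c)"
    using ne by (simp only: scaleR_cancel_left) simp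
  then have eq: "(1 - s') *\<^sub>R a + s' *\<^sub>R b = (1 - s) *\<^sub>R c + s *\<^sub>R d"
    by (simp add: algebra_simps)
  have "a \<noteq> b" "c \<noteq> d" using assms by (auto simp: cross_def)
  have "(1 - s') *\<^sub>R a + s' *\<^sub>R b \<in> open_segment a b"
    using ratio[of x' y'] assms(2) \<open>a \<noteq> b\<close> unfolding in_segment s'_def x'_def y'_def by blast
  moreover have "(1 - s) *\<^sub>R c + s *\<^sub>R d \<in> open_segment c d"
    using ratio[of x y] assms(1) \<open>c \<noteq> d\<close> unfolding in_segment s_def x_def y_def by blast
  ultimately show ?thesis unfolding eq by blast
qed

text \<open>Chords that meet must have interleaved ends: ends that are not interleaved lie on one side of the
other chord. Interleaving also makes the two directions linearly independent, so
the sign of a crossing changes as it should under reversals and exchanges.\<close>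

lemma crossing_interleaves:
  assumes p: "clockwise_on_circle N p" and ab: "a \<in> {1..N}" "b \<in> {1..N}" "a \<noteq> b"
    and "c \<in> {1..N}" "d \<in> {1..N}" "{a, b} \<inter> {c, d} = {}"
    and cr: "crossing N p (a, b) (c, d)"
  shows "cyclic_between a b c \<noteq> cyclic_between a b d"
    and "cross (direction p (a, b)) (direction p (c, d)) \<noteq> 0"
proof -
  note c = clockwise_side[OF p ab(1,2) \<open>c \<in> {1..N}\<close> ab(3)]
  note d = clockwise_side[OF p ab(1,2) \<open>d \<in> {1..N}\<close> ab(3)]
  have ne: "c \<noteq> a" "c \<noteq> b" "d \<noteq> a" "d \<noteq> b" using assms by auto
  have "\<not> cross (p b - p a) (p c - p a) * cross (p b - p a) (p d - p a) > 0"
    using cr open_segments_disjoint unfolding crossing_def by (metis fst_conv snd_conv)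
  then show inter: "cyclic_between a b c \<noteq> cyclic_between a b d"
    using c[OF ne(1,2)] d[OF ne(3,4)] mult_pos_pos mult_neg_neg by blast
  have "cross (direction p (a, b)) (direction p (c, d))
      = cross (p b - p a) (p d - p a) - cross (p b - p a) (p c - p a)"
    by (simp add: direction_def cross_def algebra_simps)
  then show "cross (direction p (a, b)) (direction p (c, d)) \<noteq> 0"
    using inter c[OF ne(1,2)] d[OF ne(3,4)] by (cases "cyclic_between a b c") force+
qed

lemma interior_skip:
  assumes "1 \<le> j" "j + 2 \<le> N" "j \<noteq> 1 \<or> j + 2 \<noteq> N"
  shows "{j, j + 2} \<in> interior_edges N"
proof -
  have "{j, j + 2} \<notin> exterior_edges N"
  proof
    assume "{j, j + 2} \<in> exterior_edges N"
    then obtain i where i: "1 \<le> i" "i \<le> N" "{j, j + 2} = {i, i mod N + 1}"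
      by (auto simp: exterior_edges_def)
    show False
    proof (cases "i = N")
      case True then show False using i assms by (auto simp: doubleton_eq_iff)
    next
      case False then have "i mod N = i" using i by simp
      then show False using i by (auto simp: doubleton_eq_iff)
    qed
  qed
  moreover have "{j, j + 2} \<in> complete_edges N"
    using assms unfolding complete_edges_def by force
  ultimately show ?thesis by (simp add: interior_edges_def)
qed

text \<open>Four consecutive vertices that alternate between two cycles give a crossing. This is the only
source of crossings that the lower bound exploits.\<close>

lemma crossing_skips:
  assumes p: "clockwise_on_circle N p" and "1 \<le> j" "j + 3 \<le> N"
  shows "crossing N p (j, j + 2) (j + 1, j + 3)"
proof -
  note side = clockwise_side[OF p]
  have "cross (p (j+2) - p j) (p (j+1) - p j) > 0" "cross (p (j+2) - p j) (p (j+3) - p j) < 0"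
    "cross (p (j+3) - p (j+1)) (p j - p (j+1)) < 0" "cross (p (j+3) - p (j+1)) (p (j+2) - p (j+1)) > 0"
    using assms by (auto intro!: side simp: cyclic_between_def)
  then have "open_segment (p j) (p (j+2)) \<inter> open_segment (p (j+1)) (p (j+3)) \<noteq> {}"
    by (intro open_segments_meet) (simp_all add: mult_pos_neg mult_neg_pos)
  moreover have "{j, j+2} \<in> interior_edges N" using assms by (intro interior_skip) auto
  moreover have "{j+1, j+3} \<in> interior_edges N" using interior_skip[of "j+1" N] assms by (simp add: numeral_eq_Suc)
  ultimately show ?thesis by (simp add: crossing_def end_points_def)
qed

section \<open>Directed edges of a cycle\<close>

lemma directed_edges_rotate [simp]: "directed_edges (rotate m vs) = directed_edges vs"
proof -
  have sub: "directed_edges (rotate m vs) \<subseteq> directed_edges vs" for m and vs :: "nat list"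
  proof
    fix d assume "d \<in> directed_edges (rotate m vs)"
    then obtain i where i: "i < length vs"
      and d: "d = (rotate m vs ! i, rotate m vs ! (Suc i mod length vs))"
      by (auto simp: directed_edges_def)
    have pos: "0 < length vs" using i by linarith
    let ?k = "(m + i) mod length vs"
    have "d = (vs ! ?k, vs ! (Suc ?k mod length vs))"
      using i pos by (simp add: d nth_rotate mod_simps)
    then show "d \<in> directed_edges vs" using pos by (auto simp: directed_edges_def)
  qed
  show ?thesis
  proof (cases "vs = []")
    case False
    let ?L = "length vs"
    have "(?L - m mod ?L + m) mod ?L = 0"
    proof -
      have "m mod ?L < ?L" using False by simp
      moreover have "m mod ?L + ?L * (m div ?L) = m" by (rule mod_mult_div_eq)
      ultimately have "?L - m mod ?L + m = ?L + ?L * (m div ?L)" by linarith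
      then show ?thesis by simp
    qed
    then have "rotate (?L - m mod ?L) (rotate m vs) = vs"
      by (simp add: rotate_rotate)
    then show ?thesis using sub[of m vs] sub[of "?L - m mod ?L" "rotate m vs"] by auto
  qed simp
qed

lemma directed_edges_rev: "directed_edges (rev vs) = (directed_edges vs)\<inverse>"
proof -
  have sub: "directed_edges (rev vs) \<subseteq> (directed_edges vs)\<inverse>" for vs :: "nat list"
  proof
    fix d assume "d \<in> directed_edges (rev vs)"
    then obtain i where i: "i < length vs"
      and d: "d = (rev vs ! i, rev vs ! (Suc i mod length vs))"
      by (auto simp: directed_edges_def)
    show "d \<in> (directed_edges vs)\<inverse>"
    proof (cases "Suc i < length vs")
      case True
      \<comment> \<open>The edge number \<open>i\<close> of the reversed list is the reversal of edge number \<open>?k\<close>.\<close>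
    let ?k = "length vs - Suc (Suc i)"
      have "?k < length vs" "Suc ?k mod length vs = length vs - Suc i" using True by auto
      moreover have "d = (vs ! (length vs - Suc i), vs ! ?k)"
        using True by (simp add: d rev_nth)
      ultimately show ?thesis by (auto simp: directed_edges_def)
    next
      case False
      then have L: "length vs = Suc i" using i by simp
      then have "d = (vs ! 0, vs ! i)" by (simp add: d rev_nth)
      then show ?thesis using L by (force simp: directed_edges_def)
    qed
  qed
  from sub[of vs] sub[of "rev vs"] show ?thesis by auto
qed

lemma end_points_swap [simp]: "end_points (prod.swap d) = end_points d"
  by (auto simp: end_points_def)

lemma converse_eq_swap: "D\<inverse> = prod.swap ` D"
  by force

lemma unoriented_rotate: "unoriented (rotate m vs) = unoriented vs"
  by (simp add: unoriented_def)

lemma unoriented_rev: "unoriented (rev vs) = unoriented vs"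
  by (simp add: unoriented_def directed_edges_rev converse_eq_swap image_image)

lemma directed_edges_vertices: "(x, y) \<in> directed_edges vs \<Longrightarrow> x \<in> set vs \<and> y \<in> set vs"
  by (auto simp: directed_edges_def intro!: nth_mem mod_less_divisor)

lemma Union_unoriented: "\<Union>(unoriented vs) = set vs"
proof
  show "\<Union>(unoriented vs) \<subseteq> set vs"
    by (auto simp: unoriented_def end_points_def dest: directed_edges_vertices)
  show "set vs \<subseteq> \<Union>(unoriented vs)"
    by (force simp: unoriented_def end_points_def directed_edges_def in_set_conv_nth)
qed

lemma finite_directed_edges [simp]: "finite (directed_edges vs)"
  by (simp add: directed_edges_def)

lemma card_directed_edges_le: "card (directed_edges vs) \<le> length vs"
proof -
  have "directed_edges vs = (\<lambda>i. (vs ! i, vs ! (Suc i mod length vs))) ` {..<length vs}"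
    by (auto simp: directed_edges_def)
  then show ?thesis using card_image_le[of "{..<length vs}"] by simp
qed

lemma directed_edges_unique_target:
  assumes "distinct vs" "(x, y) \<in> directed_edges vs" "(x, z) \<in> directed_edges vs"
  shows "y = z"
  using assms by (auto simp: directed_edges_def nth_eq_iff_index_eq)

lemma directed_edges_unique_source:
  assumes "distinct vs" "(x, z) \<in> directed_edges vs" "(y, z) \<in> directed_edges vs"
  shows "x = y"
  using directed_edges_unique_target[of "rev vs" z x y] assms by (simp add: directed_edges_rev)

lemma directed_edges_nth:
  assumes "vs \<noteq> []"
  shows "(vs ! (i mod length vs), vs ! (Suc i mod length vs)) \<in> directed_edges vs"
  unfolding directed_edges_def using assms
  by (auto intro!: exI[of _ "i mod length vs"] simp: mod_simps)

lemma nth_mod_neq: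
  assumes "distinct vs" "0 < k" "k < length vs"
  shows "vs ! (i mod length vs) \<noteq> vs ! ((i + k) mod length vs)"
proof
  assume "vs ! (i mod length vs) = vs ! ((i + k) mod length vs)"
  then have "(i + 0) mod length vs = (i + k) mod length vs"
    using assms nth_eq_iff_index_eq[OF assms(1), of "i mod length vs" "(i + k) mod length vs"]
    by (simp add: mod_less_divisor[OF less_trans[OF assms(2,3)]])
  then have "(i + k) mod length vs = i mod length vs" by simp
  then have "length vs dvd (i + k) - i" by (rule mod_eq_dvd_iff_nat[THEN iffD1, rotated]) simp
  then have "length vs dvd k" by simp
  then show False using dvd_imp_le assms(2,3) by fastforce
qed

lemma directed_edges_antisym:
  assumes "distinct vs" "length vs \<ge> 3" "(x, y) \<in> directed_edges vs"
  shows "(y, x) \<notin> directed_edges vs" and "x \<noteq> y"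
proof -
  obtain i where i: "i < length vs" "x = vs ! i" "y = vs ! (Suc i mod length vs)"
    using assms(3) by (auto simp: directed_edges_def)
  have "(y, vs ! (Suc (Suc i) mod length vs)) \<in> directed_edges vs"
    using directed_edges_nth[of vs "Suc i"] assms i by fastforce
  moreover have "x \<noteq> vs ! (Suc (Suc i) mod length vs)"
    using nth_mod_neq[of vs 2 i] assms i by simp
  ultimately show "(y, x) \<notin> directed_edges vs"
    using directed_edges_unique_target[OF assms(1)] by blast
  show "x \<noteq> y" using nth_mod_neq[of vs 1 i] assms i by simp
qed

lemma end_points_eq_iff: "end_points d = end_points d' \<longleftrightarrow> d' = d \<or> d' = prod.swap d"
  by (cases d; cases d') (auto simp: end_points_def doubleton_eq_iff)

text \<open>An unoriented cycle has only two orientations. Once one edge of \<open>vs\<close> is traversed by \<open>ws\<close>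
in the same direction, so is the next: were it reversed, its end would be a second predecessor in
\<open>ws\<close> of a vertex that already has one, and the two predecessors differ because the
cycle has at least three vertices. If the first edge is reversed, the same argument applies to
\<open>rev ws\<close>.\<close>

lemma unoriented_eq_imp:
  assumes vs: "distinct vs" "length vs \<ge> 3" and ws: "distinct ws" "length ws \<ge> 3"
    and eq: "unoriented vs = unoriented ws"
  shows "directed_edges ws = directed_edges vs \<or> directed_edges ws = (directed_edges vs)\<inverse>"
proof -
  have either: "(x, y) \<in> directed_edges w \<or> (y, x) \<in> directed_edges w"
    if "(x, y) \<in> directed_edges v" "unoriented v = unoriented w" for x y v w
  proof -
    have "end_points (x, y) \<in> unoriented w" using that by (auto simp: unoriented_def)
    then obtain d where "d \<in> directed_edges w" "end_points (x, y) = end_points d"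
      by (auto simp: unoriented_def)
    then show ?thesis by (auto simp: end_points_eq_iff)
  qed
  have same: "directed_edges w = directed_edges vs"
    if w: "distinct w" "length w \<ge> 3" and eqw: "unoriented vs = unoriented w"
      and start: "(vs ! 0, vs ! (Suc 0 mod length vs)) \<in> directed_edges w" for w
  proof -
    have ne: "vs \<noteq> []" using vs by auto
    have all: "(vs ! (i mod length vs), vs ! (Suc i mod length vs)) \<in> directed_edges w" for i
    proof (induction i)
      case 0 then show ?case using start ne by simp
    next
      case (Suc i)
      consider "(vs ! (Suc i mod length vs), vs ! (Suc (Suc i) mod length vs)) \<in> directed_edges w"
        | "(vs ! (Suc (Suc i) mod length vs), vs ! (Suc i mod length vs)) \<in> directed_edges w"
        using either[OF directed_edges_nth[OF ne] eqw] by blast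
      then show ?case
      proof cases
        case 2
        then have "vs ! (i mod length vs) = vs ! (Suc (Suc i) mod length vs)"
          using Suc directed_edges_unique_source[OF w(1)] by blast
        then show ?thesis using nth_mod_neq[of vs 2 i] vs by simp
      qed
    qed
    have sub: "directed_edges vs \<subseteq> directed_edges w"
    proof
      fix d assume "d \<in> directed_edges vs"
      then obtain i where "i < length vs" "d = (vs ! i, vs ! (Suc i mod length vs))"
        by (auto simp: directed_edges_def)
      then show "d \<in> directed_edges w" using all[of i] by simp
    qed
    moreover have "(x, y) \<in> directed_edges vs" if "(x, y) \<in> directed_edges w" for x y
      using either[OF that eqw[symmetric]] sub directed_edges_antisym(1)[OF w that] by blast
    ultimately show ?thesis by auto
  qed
  have "(vs ! 0, vs ! (Suc 0 mod length vs)) \<in> directed_edges vs"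
    using directed_edges_nth[of vs 0] vs by fastforce
  from either[OF this eq] show ?thesis
  proof
    assume "(vs ! 0, vs ! (Suc 0 mod length vs)) \<in> directed_edges ws"
    then show ?thesis using same[OF ws eq] by blast
  next
    assume "(vs ! (Suc 0 mod length vs), vs ! 0) \<in> directed_edges ws"
    then have "directed_edges (rev ws) = directed_edges vs"
      using same[of "rev ws"] ws eq by (simp add: unoriented_rev directed_edges_rev)
    then show ?thesis by (auto simp: directed_edges_rev)
  qed
qed

text \<open>An increasing cycle runs once around the circle, so each of its edges jumps to the
clockwise next vertex of the cycle. The edge from the last to the first vertex is the one for which
the wrapping branch of \<open>cyclic_between\<close> is needed.\<close>

lemma sorted_directed_edge_empty_arc:
  assumes sorted: "sorted_wrt (<) vs" and "(x, y) \<in> directed_edges vs" and "z \<in> set vs"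
  shows "\<not> cyclic_between x y z"
proof -
  have le: "vs ! i \<le> vs ! j" if "i \<le> j" "j < length vs" for i j
    using sorted_wrt_nth_less[OF sorted, of i j] that by (cases "i = j") auto
  obtain i where i: "i < length vs" "x = vs ! i" "y = vs ! (Suc i mod length vs)"
    using assms(2) by (auto simp: directed_edges_def)
  obtain k where k: "k < length vs" "z = vs ! k"
    using assms(3) by (auto simp: in_set_conv_nth)
  show ?thesis
  proof (cases "Suc i < length vs")
    case True
    then have "x < y" using sorted_wrt_nth_less[OF sorted, of i "Suc i"] i by simp
    moreover have "z \<le> x \<or> y \<le> z"
      using le[of k i] le[of "Suc i" k] True i k by (cases "k \<le> i") auto
    ultimately show ?thesis by (auto simp: cyclic_between_def)
  next
    case False
    then have "Suc i = length vs" using i by simp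
    then have "y \<le> x" "y \<le> z" "z \<le> x" using le[of 0 i] le[of 0 k] le[of k i] i k by auto
    then show ?thesis by (auto simp: cyclic_between_def)
  qed
qed

lemma sorted_consecutive_directed_edge:
  assumes sorted: "sorted_wrt (<) vs" and "x \<in> set vs" "y \<in> set vs" "x < y"
    and empty: "\<And>z. z \<in> set vs \<Longrightarrow> \<not> (x < z \<and> z < y)"
  shows "(x, y) \<in> directed_edges vs"
proof -
  note less = sorted_wrt_nth_less[OF sorted]
  obtain i k where ik: "i < length vs" "x = vs ! i" "k < length vs" "y = vs ! k"
    using assms by (auto simp: in_set_conv_nth)
  have "i < k"
  proof (rule ccontr)
    assume "\<not> i < k"
    then have "y \<le> x" using less[of k i] ik by (cases "k = i") auto
    then show False using \<open>x < y\<close> by simp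
  qed
  have "k = Suc i"
  proof (rule ccontr)
    assume "k \<noteq> Suc i"
    then have "x < vs ! Suc i" "vs ! Suc i < y" using less[of i "Suc i"] less[of "Suc i" k] \<open>i < k\<close> ik by auto
    then show False using empty[of "vs ! Suc i"] \<open>i < k\<close> ik by auto
  qed
  then show ?thesis using ik by (force simp: directed_edges_def)
qed

section \<open>Pairs of disjoint monotonic cycles\<close>

abbreviation increasing_cycle :: "nat set \<Rightarrow> nat list" where
  "increasing_cycle A \<equiv> sorted_list_of_set A"

lemma unoriented_monotonic:
  assumes "monotonic vs"
  shows "unoriented vs = unoriented (increasing_cycle (set vs))"
proof -
  have sorted: "us = increasing_cycle (set us)" if "sorted_wrt (<) us" for us :: "nat list"
    using that by (simp add: strict_sorted_iff sorted_list_of_set.idem_if_sorted_distinct)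
  from assms consider m where "sorted_wrt (<) (rotate m vs)" | m where "sorted_wrt (>) (rotate m vs)"
    unfolding monotonic_def strictly_increasing_def strictly_decreasing_def by blast
  then show ?thesis
  proof cases
    case (1 m)
    show ?thesis
      using arg_cong[OF sorted[OF 1], of unoriented] by (simp only: unoriented_rotate set_rotate)
  next
    case (2 m)
    then have "sorted_wrt (<) (rev (rotate m vs))" by (simp add: sorted_wrt_rev)
    from arg_cong[OF sorted[OF this], of unoriented] show ?thesis
      by (simp only: unoriented_rotate unoriented_rev set_rotate set_rev)
  qed
qed

lemma monotonic_cycles_eq:
  assumes "k \<ge> 3"
  shows "monotonic_cycles N k = (\<lambda>A. unoriented (increasing_cycle A)) ` {A. A \<subseteq> {1..N} \<and> card A = k}"
proof (intro equalityI subsetI)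
  fix P assume "P \<in> monotonic_cycles N k"
  then obtain vs where vs: "P = unoriented vs" "oriented_cycle N vs" "length vs = k" "monotonic vs"
    by (auto simp: monotonic_cycles_def)
  then have "set vs \<subseteq> {1..N}" "card (set vs) = k"
    by (auto simp: oriented_cycle_def distinct_card)
  then show "P \<in> (\<lambda>A. unoriented (increasing_cycle A)) ` {A. A \<subseteq> {1..N} \<and> card A = k}"
    using vs unoriented_monotonic[OF vs(4)] by blast
next
  fix P assume "P \<in> (\<lambda>A. unoriented (increasing_cycle A)) ` {A. A \<subseteq> {1..N} \<and> card A = k}"
  then obtain A where A: "P = unoriented (increasing_cycle A)" "A \<subseteq> {1..N}" "card A = k" by auto
  then have "finite A" using finite_subset by blast
  then have "oriented_cycle N (increasing_cycle A)" "length (increasing_cycle A) = k"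
    using A assms by (auto simp: oriented_cycle_def)
  moreover have "monotonic (increasing_cycle A)"
    unfolding monotonic_def strictly_increasing_def by (rule disjI1, rule exI[of _ 0]) simp
  ultimately show "P \<in> monotonic_cycles N k" using A(1) unfolding monotonic_cycles_def by blast
qed

text \<open>Two disjoint \<open>n\<close>-cycles in \<open>K\<^sub>2\<^sub>n\<close> use all vertices, so a pair of monotonic ones is
given by a set of \<open>n\<close> vertices and its complement. Asking that the set contain the vertex \<open>1\<close>
selects one of the two, and makes the uniform distribution on unordered pairs
a uniform distribution on sets.\<close>

definition half_sets :: "nat \<Rightarrow> nat set set" where
  "half_sets n = {A. A \<subseteq> {1..2 * n} \<and> card A = n \<and> 1 \<in> A}"

definition cycle_pair :: "nat \<Rightarrow> nat set \<Rightarrow> nat set set set" where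
  "cycle_pair n A = {unoriented (increasing_cycle A), unoriented (increasing_cycle ({1..2 * n} - A))}"

lemma Union_unoriented_increasing_cycle:
  "finite A \<Longrightarrow> \<Union>(unoriented (increasing_cycle A)) = A"
  by (simp add: Union_unoriented)

lemma disjoint_monotonic_pairs_eq:
  assumes "n \<ge> 3"
  shows "disjoint_monotonic_pairs (2 * n) n = cycle_pair n ` half_sets n"
proof (intro equalityI subsetI)
  fix S assume "S \<in> disjoint_monotonic_pairs (2 * n) n"
  then obtain P Q where S: "S = {P, Q}" and PQ: "P \<in> monotonic_cycles (2 * n) n" "Q \<in> monotonic_cycles (2 * n) n"
    and disj: "\<Union>P \<inter> \<Union>Q = {}"
    unfolding disjoint_monotonic_pairs_def by blast
  from PQ obtain A B where P: "P = unoriented (increasing_cycle A)" and Q: "Q = unoriented (increasing_cycle B)"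
    and A: "A \<subseteq> {1..2 * n}" "card A = n" and B: "B \<subseteq> {1..2 * n}" "card B = n"
    unfolding monotonic_cycles_eq[OF assms] by blast
  have fin: "finite A" "finite B" using A B finite_subset by blast+
  have AB: "A \<inter> B = {}"
    using disj unfolding P Q by (simp only: Union_unoriented_increasing_cycle fin)
  have "A \<union> B = {1..2 * n}"
    using A B fin AB by (intro card_subset_eq) (simp_all add: card_Un_disjoint)
  then have compl: "B = {1..2 * n} - A" "A = {1..2 * n} - B" and "1 \<in> A \<or> 1 \<in> B"
    using AB assms by auto
  have "S = cycle_pair n A"
    unfolding cycle_pair_def S P Q compl(1)[symmetric] ..
  moreover have "S = cycle_pair n B"
    unfolding cycle_pair_def S P Q compl(2)[symmetric] by (rule insert_commute)
  moreover have "A \<in> half_sets n \<or> B \<in> half_sets n"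
    using A B \<open>1 \<in> A \<or> 1 \<in> B\<close> unfolding half_sets_def by blast
  ultimately show "S \<in> cycle_pair n ` half_sets n" by blast
next
  fix S assume "S \<in> cycle_pair n ` half_sets n"
  then obtain A where A: "A \<subseteq> {1..2 * n}" "card A = n" and S: "S = cycle_pair n A"
    by (auto simp: half_sets_def)
  let ?B = "{1..2 * n} - A"
  have fin: "finite A" "finite ?B" using A finite_subset by blast+
  have "card ?B = n" using A fin by (simp add: card_Diff_subset)
  then have "unoriented (increasing_cycle A) \<in> monotonic_cycles (2 * n) n"
    "unoriented (increasing_cycle ?B) \<in> monotonic_cycles (2 * n) n"
    unfolding monotonic_cycles_eq[OF assms] using A by blast+
  moreover have "\<Union>(unoriented (increasing_cycle A)) \<inter> \<Union>(unoriented (increasing_cycle ?B)) = {}"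
    unfolding Union_unoriented_increasing_cycle[OF fin(1)] Union_unoriented_increasing_cycle[OF fin(2)] by blast
  ultimately show "S \<in> disjoint_monotonic_pairs (2 * n) n"
    unfolding disjoint_monotonic_pairs_def S cycle_pair_def by blast
qed

lemma inj_on_cycle_pair: "inj_on (cycle_pair n) (half_sets n)"
proof (rule inj_onI)
  fix A B assume A: "A \<in> half_sets n" and B: "B \<in> half_sets n" and eq: "cycle_pair n A = cycle_pair n B"
  have unions: "Union ` cycle_pair n X = {X, {1..2 * n} - X}" if "X \<in> half_sets n" for X
  proof -
    have "X \<subseteq> {1..2 * n}" using that unfolding half_sets_def by blast
    then have "finite X" by (rule finite_subset) simp
    moreover have "finite ({1..2 * n} - X)" by simp
    ultimately show ?thesis
      unfolding cycle_pair_def image_insert image_empty by (simp only: Union_unoriented_increasing_cycle)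
  qed
  have "A \<in> Union ` cycle_pair n A" unfolding unions[OF A] by (rule insertI1)
  then have "A \<in> {B, {1..2 * n} - B}" unfolding eq unions[OF B] .
  moreover have "1 \<in> A" "1 \<in> B" using A B unfolding half_sets_def by blast+
  ultimately show "A = B" by blast
qed

section \<open>Comparisons in a random permutation\<close>

text \<open>The sign of a crossing depends on \<open>\<sigma>\<close> only through a factor of this form.\<close>

definition comparison :: "('a \<Rightarrow> nat) \<Rightarrow> 'a \<Rightarrow> 'a \<Rightarrow> real" where
  "comparison \<sigma> a b = (if \<sigma> a > \<sigma> b then 1 else - 1)"

text \<open>Exchanging \<open>a\<close> and \<open>b\<close> in a permutation negates the first factor and preserves the second, so
comparisons of disjoint pairs are uncorrelated.\<close>

lemma sum_comparison_disjoint: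
  fixes S :: "nat set"
  assumes "finite S" "a \<in> S" "b \<in> S" "a \<noteq> b" "c \<notin> {a, b}" "d \<notin> {a, b}"
  shows "(\<Sum>\<sigma> | \<sigma> permutes S. comparison \<sigma> a b * comparison \<sigma> c d) = 0"
proof -
  let ?t = "Transposition.transpose a b"
  have "(\<Sum>\<sigma> | \<sigma> permutes S. comparison \<sigma> a b * comparison \<sigma> c d)
      = (\<Sum>\<sigma> | \<sigma> permutes S. comparison (\<sigma> \<circ> ?t) a b * comparison (\<sigma> \<circ> ?t) c d)"
    using assms by (intro sum_permutations_compose_right permutes_swap_id)
  also have "\<dots> = (\<Sum>\<sigma> | \<sigma> permutes S. - (comparison \<sigma> a b * comparison \<sigma> c d))"
  proof (rule sum.cong[OF refl])
    fix \<sigma> assume "\<sigma> \<in> {\<sigma>. \<sigma> permutes S}"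
    then have "\<sigma> a \<noteq> \<sigma> b" using assms by (metis mem_Collect_eq permutes_inj injD)
    then show "comparison (\<sigma> \<circ> ?t) a b * comparison (\<sigma> \<circ> ?t) c d = - (comparison \<sigma> a b * comparison \<sigma> c d)"
      using assms by (auto simp: comparison_def Transposition.transpose_def)
  qed
  finally show ?thesis by (simp add: sum_negf)
qed

text \<open>Comparisons that share one member have correlation \<open>1/3\<close>. Among three distinct heights
the product at the largest and that at the smallest is \<open>1\<close>, and that at the middle one is \<open>-1\<close>;
so the three products sum to \<open>1\<close>, and by symmetry they have the same mean.\<close>

lemma sum_comparison_shared:
  fixes S :: "nat set"
  assumes "finite S" "a \<in> S" "b \<in> S" "c \<in> S" "a \<noteq> b" "a \<noteq> c" "b \<noteq> c"
  shows "(\<Sum>\<sigma> | \<sigma> permutes S. comparison \<sigma> a b * comparison \<sigma> a c) = fact (card S) / 3"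
proof -
  define E where "E x y z = (\<Sum>\<sigma> | \<sigma> permutes S. comparison \<sigma> x y * comparison \<sigma> x z)" for x y z
  have swap: "E x y z = (\<Sum>\<sigma> | \<sigma> permutes S. comparison \<sigma> (t x) (t y) * comparison \<sigma> (t x) (t z))"
    if "t permutes S" for x y z t
    unfolding E_def using sum_permutations_compose_right[OF that, of "\<lambda>\<sigma>. comparison \<sigma> x y * comparison \<sigma> x z"]
    by (simp add: comparison_def)
  have b: "E a b c = E b a c"
    using swap[of "Transposition.transpose a b" a b c] assms by (simp add: E_def permutes_swap_id Transposition.transpose_def)
  have c: "E a b c = E c b a"
    using swap[of "Transposition.transpose a c" a b c] assms by (simp add: E_def permutes_swap_id Transposition.transpose_def)
  have "E a b c + E b a c + E c b a = (\<Sum>\<sigma> | \<sigma> permutes S. 1)"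
    unfolding E_def sum.distrib[symmetric]
  proof (rule sum.cong[OF refl])
    fix \<sigma> assume "\<sigma> \<in> {\<sigma>. \<sigma> permutes S}"
    then have "\<sigma> a \<noteq> \<sigma> b" "\<sigma> a \<noteq> \<sigma> c" "\<sigma> b \<noteq> \<sigma> c"
      using assms by (metis mem_Collect_eq permutes_inj injD)+
    then show "comparison \<sigma> a b * comparison \<sigma> a c + comparison \<sigma> b a * comparison \<sigma> b c
        + comparison \<sigma> c b * comparison \<sigma> c a = 1"
      by (auto simp: comparison_def)
  qed
  also have "\<dots> = fact (card S)" using assms(1) by (simp add: card_permutations)
  finally show ?thesis using b c unfolding E_def by linarith
qed

lemma comparison_antisym:
  assumes "\<sigma> a \<noteq> \<sigma> b" shows "comparison \<sigma> b a = - comparison \<sigma> a b"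
  using assms by (auto simp: comparison_def)

text \<open>Signed comparisons along the edges of a bipartite graph \<open>C\<close> of maximal degree \<open>2\<close>. In the
second moment every edge contributes \<open>1\<close> for itself; it meets at most two other edges, one at
each end, and each of them contributes at most \<open>1/3\<close> in absolute value whatever the signs
\<open>w\<close> are. The total contribution of an edge is therefore between \<open>1/3\<close> and \<open>5/3\<close>.\<close>

lemma second_moment_comparisons:
  fixes C :: "('b \<times> 'b) set" and ix :: "'b \<Rightarrow> nat" and w :: "'b \<times> 'b \<Rightarrow> real"
  assumes S: "finite S" and C: "finite C"
    and ix: "inj_on ix (fst ` C \<union> snd ` C)" "ix ` (fst ` C \<union> snd ` C) \<subseteq> S"
    and bip: "fst ` C \<inter> snd ` C = {}"
    and w: "\<And>c. c \<in> C \<Longrightarrow> \<bar>w c\<bar> = 1"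
    and row: "\<And>x. card {c \<in> C. fst c = x} \<le> 2" and col: "\<And>y. card {c \<in> C. snd c = y} \<le> 2"
  defines "M \<equiv> (\<Sum>\<sigma> | \<sigma> permutes S. (\<Sum>c\<in>C. w c * comparison \<sigma> (ix (fst c)) (ix (snd c)))\<^sup>2)"
  shows "real (card C) * fact (card S) / 3 \<le> M" and "M \<le> 5 * real (card C) * fact (card S) / 3"
proof -
  define F :: real where "F = fact (card S)"
  define X where "X c \<sigma> = comparison \<sigma> (ix (fst c)) (ix (snd c))" for c \<sigma>
  define T where "T c c' = (\<Sum>\<sigma> | \<sigma> permutes S. X c \<sigma> * X c' \<sigma>)" for c c'
  have Fpos: "F > 0" by (simp add: F_def)
  have M: "M = (\<Sum>c\<in>C. \<Sum>c'\<in>C. w c * w c' * T c c')"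
  proof -
    have "M = (\<Sum>\<sigma> | \<sigma> permutes S. \<Sum>c\<in>C. \<Sum>c'\<in>C. w c * w c' * (X c \<sigma> * X c' \<sigma>))"
      unfolding M_def X_def power2_eq_square sum_product by (simp add: mult_ac)
    also have "\<dots> = (\<Sum>c\<in>C. \<Sum>\<sigma> | \<sigma> permutes S. \<Sum>c'\<in>C. w c * w c' * (X c \<sigma> * X c' \<sigma>))"
      by (rule sum.swap)
    also have "\<dots> = (\<Sum>c\<in>C. \<Sum>c'\<in>C. \<Sum>\<sigma> | \<sigma> permutes S. w c * w c' * (X c \<sigma> * X c' \<sigma>))"
      by (rule sum.cong[OF refl], rule sum.swap)
    finally show ?thesis by (simp add: T_def sum_distrib_left)
  qed
  have inS: "ix (fst c) \<in> S" "ix (snd c) \<in> S" if "c \<in> C" for c using ix(2) that by auto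
  have cross_ne: "ix (fst c) \<noteq> ix (snd c')" if "c \<in> C" "c' \<in> C" for c c'
  proof
    assume "ix (fst c) = ix (snd c')"
    then have "fst c = snd c'" using inj_onD[OF ix(1)] that by blast
    then show False using bip that by (metis disjoint_iff image_eqI)
  qed
  have fst_ne: "ix (fst c) \<noteq> ix (fst c')" if "c \<in> C" "c' \<in> C" "fst c \<noteq> fst c'" for c c'
    using inj_onD[OF ix(1)] that by blast
  have snd_ne: "ix (snd c) \<noteq> ix (snd c')" if "c \<in> C" "c' \<in> C" "snd c \<noteq> snd c'" for c c'
    using inj_onD[OF ix(1)] that by blast
  have diag: "w c * w c * T c c = F" if "c \<in> C" for c
  proof -
    have "w c * w c = 1" using w[OF that] by (metis abs_mult_self_eq mult_1)
    moreover have "X c \<sigma> * X c \<sigma> = 1" for \<sigma> by (simp add: X_def comparison_def)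
    ultimately show ?thesis using S by (simp add: T_def F_def card_permutations)
  qed
  have off: "\<bar>T c c'\<bar> \<le> (if fst c' = fst c \<or> snd c' = snd c then F / 3 else 0)"
    if cc: "c \<in> C" "c' \<in> C" "c' \<noteq> c" for c c'
  proof -
    consider "fst c' = fst c" "snd c' \<noteq> snd c" | "fst c' \<noteq> fst c" "snd c' = snd c"
      | "fst c' \<noteq> fst c" "snd c' \<noteq> snd c"
      using cc(3) by (metis prod.expand)
    then show ?thesis
    proof cases
      case 1
      then have "T c c' = F / 3"
        using sum_comparison_shared[OF S inS(1)[OF cc(1)] inS(2)[OF cc(1)] inS(2)[OF cc(2)]]
          cross_ne[OF cc(1) cc(1)] cross_ne[OF cc(1) cc(2)] snd_ne[OF cc(1,2)]
        by (simp add: T_def X_def F_def)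
      then show ?thesis using 1 Fpos by simp
    next
      case 2
      have "X c \<sigma> * X c' \<sigma> = comparison \<sigma> (ix (snd c)) (ix (fst c)) * comparison \<sigma> (ix (snd c)) (ix (fst c'))"
        if "\<sigma> permutes S" for \<sigma>
      proof -
        have "\<sigma> (ix (fst c)) \<noteq> \<sigma> (ix (snd c))" "\<sigma> (ix (fst c')) \<noteq> \<sigma> (ix (snd c))"
          using permutes_inj[OF that] cross_ne[OF cc(1) cc(1)] cross_ne[OF cc(2) cc(1)] by (auto dest: injD)
        then have "comparison \<sigma> (ix (fst c)) (ix (snd c)) = - comparison \<sigma> (ix (snd c)) (ix (fst c))"
          "comparison \<sigma> (ix (fst c')) (ix (snd c)) = - comparison \<sigma> (ix (snd c)) (ix (fst c'))"
          by (auto simp: comparison_def)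
        then show ?thesis by (simp add: X_def 2)
      qed
      then have "T c c' = (\<Sum>\<sigma> | \<sigma> permutes S. comparison \<sigma> (ix (snd c)) (ix (fst c)) * comparison \<sigma> (ix (snd c)) (ix (fst c')))"
        unfolding T_def by (intro sum.cong) auto
      also have "\<dots> = F / 3" unfolding F_def
        using cross_ne[OF cc(1) cc(1)] cross_ne[OF cc(2) cc(1)] fst_ne[OF cc(1,2)] 2
        by (intro sum_comparison_shared S inS cc) auto
      finally show ?thesis using 2 Fpos by simp
    next
      case 3
      have "T c c' = 0" unfolding T_def X_def
        using cross_ne[OF cc(1) cc(1)] cross_ne[OF cc(2) cc(1)] cross_ne[OF cc(1) cc(2)]
          fst_ne[OF cc(1,2)] snd_ne[OF cc(1,2)] 3
        by (intro sum_comparison_disjoint S inS cc) auto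
      then show ?thesis using 3 by simp
    qed
  qed
  have row_sum: "\<bar>(\<Sum>c'\<in>C. w c * w c' * T c c') - F\<bar> \<le> 2 * F / 3" if c: "c \<in> C" for c
  proof -
    have "(\<Sum>c'\<in>C. w c * w c' * T c c') - F = (\<Sum>c'\<in>C - {c}. w c * w c' * T c c')"
      using diag[OF c] by (simp add: sum.remove[OF C c])
    also have "\<bar>\<dots>\<bar> \<le> (\<Sum>c'\<in>C - {c}. \<bar>w c * w c' * T c c'\<bar>)" by (rule sum_abs)
    also have "\<dots> = (\<Sum>c'\<in>C - {c}. \<bar>T c c'\<bar>)"
      by (intro sum.cong refl) (simp add: abs_mult w c)
    also have "\<dots> \<le> (\<Sum>c'\<in>C - {c}. if fst c' = fst c \<or> snd c' = snd c then F / 3 else 0)"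
      using off c by (intro sum_mono) auto
    also have "\<dots> = real (card {c' \<in> C - {c}. fst c' = fst c \<or> snd c' = snd c}) * (F / 3)"
      using C by (simp add: sum.If_cases Int_def)
    also have "\<dots> \<le> 2 * (F / 3)"
    proof (rule mult_right_mono)
      have sub: "{c' \<in> C - {c}. fst c' = fst c \<or> snd c' = snd c}
          = ({c' \<in> C. fst c' = fst c} - {c}) \<union> ({c' \<in> C. snd c' = snd c} - {c})" by auto
      have "card ({c' \<in> C. fst c' = fst c} - {c}) \<le> 1" "card ({c' \<in> C. snd c' = snd c} - {c}) \<le> 1"
        using c row[of "fst c"] col[of "snd c"] by (simp_all add: card_Diff_singleton)
      then show "real (card {c' \<in> C - {c}. fst c' = fst c \<or> snd c' = snd c}) \<le> 2"
        unfolding sub using card_Un_le[of "{c' \<in> C. fst c' = fst c} - {c}" "{c' \<in> C. snd c' = snd c} - {c}"] by linarith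
    qed (use Fpos in simp)
    finally show ?thesis by simp
  qed
  have lower: "F / 3 \<le> (\<Sum>c'\<in>C. w c * w c' * T c c')"
    and upper: "(\<Sum>c'\<in>C. w c * w c' * T c c') \<le> 5 * F / 3" if "c \<in> C" for c
    using row_sum[OF that] by linarith+
  have "real (card C) * (F / 3) \<le> M"
    unfolding M by (rule sum_bounded_below) (rule lower)
  then show "real (card C) * fact (card S) / 3 \<le> M" by (simp add: F_def)
  have "M \<le> real (card C) * (5 * F / 3)"
    unfolding M by (rule sum_bounded_above) (rule upper)
  then show "M \<le> 5 * real (card C) * fact (card S) / 3" by (simp add: F_def mult_ac)
qed

section \<open>The linking number and its independence of orientations\<close>

text \<open>The number under which the permutation of the heights knows an edge.\<close>

definition edge_index :: "nat \<Rightarrow> (nat \<Rightarrow> nat set) \<Rightarrow> nat \<times> nat \<Rightarrow> nat" where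
  "edge_index N e d = inv_into {1..num_interior N} e (end_points d)"

lemma edge_index_swap [simp]: "edge_index N e (prod.swap d) = edge_index N e d"
  by (simp add: edge_index_def)

lemma edge_index:
  assumes "interior_enumeration N e" "end_points d \<in> interior_edges N"
  shows "edge_index N e d \<in> {1..num_interior N}" "e (edge_index N e d) = end_points d"
proof -
  have "end_points d \<in> e ` {1..num_interior N}"
    using assms by (auto simp: interior_enumeration_def bij_betw_def)
  then show "edge_index N e d \<in> {1..num_interior N}" "e (edge_index N e d) = end_points d"
    unfolding edge_index_def by (rule inv_into_into, rule f_inv_into_f)
qed

lemma above_iff:
  assumes e: "interior_enumeration N e"
    and d: "end_points d \<in> interior_edges N" "end_points d' \<in> interior_edges N"
  shows "above N e \<sigma> (end_points d) (end_points d') \<longleftrightarrow> \<sigma> (edge_index N e d') < \<sigma> (edge_index N e d)"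
proof -
  have inj: "inj_on e {1..num_interior N}"
    using e by (auto simp: interior_enumeration_def bij_betw_def)
  have "i = edge_index N e c" if "i \<in> {1..num_interior N}" "end_points c = e i" "end_points c \<in> interior_edges N" for i c
    using inj_onD[OF inj _ that(1) edge_index(1)[OF e that(3)]] edge_index(2)[OF e that(3)] that by simp
  then show ?thesis
    using edge_index[OF e d(1)] edge_index[OF e d(2)] d unfolding above_def by metis
qed

text \<open>The sign of a crossing splits into a geometric factor that does not depend on the permutation and
a comparison of heights that does not depend on the geometry. Determinant \<open>0\<close> has to be
excluded, since \<open>crossing_sign\<close> is then \<open>-1\<close> whichever edge is above.\<close>

lemma crossing_sign_eq:
  assumes "interior_enumeration N e" "crossing N p d d'"
    and "cross (direction p d) (direction p d') \<noteq> 0"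
  shows "crossing_sign N p e \<sigma> d d' = sgn (cross (direction p d) (direction p d'))
      * comparison \<sigma> (edge_index N e d) (edge_index N e d')"
proof -
  have "above N e \<sigma> (end_points d) (end_points d') \<longleftrightarrow> \<sigma> (edge_index N e d') < \<sigma> (edge_index N e d)"
    using assms by (intro above_iff) (auto simp: crossing_def)
  moreover have "positively_oriented z w \<longleftrightarrow> cross z w > 0" for z w
    by (simp add: positively_oriented_def cross_def)
  ultimately show ?thesis
    using assms(3) cross_commute[of "direction p d'" "direction p d"]
    by (auto simp: crossing_sign_def comparison_def sgn_real_def)
qed

lemma crossing_commute: "crossing N p d' d \<longleftrightarrow> crossing N p d d'"
  by (auto simp: crossing_def)

lemma crossing_swap: "crossing N p (prod.swap d) d' \<longleftrightarrow> crossing N p d d'"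
  by (simp add: crossing_def open_segment_commute)

lemma direction_swap: "direction p (prod.swap d) = - direction p d"
  by (simp add: direction_def)

definition crossings :: "nat \<Rightarrow> (nat \<Rightarrow> complex) \<Rightarrow> nat list \<Rightarrow> nat list \<Rightarrow> ((nat \<times> nat) \<times> (nat \<times> nat)) set" where
  "crossings N p vs ws = {(d, d') \<in> directed_edges vs \<times> directed_edges ws. crossing N p d d'}"

lemma finite_crossings [simp]: "finite (crossings N p vs ws)"
  by (rule finite_subset[of _ "directed_edges vs \<times> directed_edges ws"]) (auto simp: crossings_def)

lemma linking_number_eq:
  "linking_number N p e \<sigma> vs ws = (\<Sum>(d, d')\<in>crossings N p vs ws. crossing_sign N p e \<sigma> d d') / 2"
  by (simp add: linking_number_def crossings_def)

lemma crossings_of_disjoint_cycles: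
  assumes p: "clockwise_on_circle N p" and vs: "oriented_cycle N vs" and ws: "oriented_cycle N ws"
    and disj: "set vs \<inter> set ws = {}" and c: "((a, b), (c, d)) \<in> crossings N p vs ws"
  shows "cyclic_between a b c \<noteq> cyclic_between a b d"
    and "cyclic_between c d a \<noteq> cyclic_between c d b"
    and "cross (direction p (a, b)) (direction p (c, d)) \<noteq> 0"
    and "end_points (a, b) \<noteq> end_points (c, d)"
proof -
  have ab: "(a, b) \<in> directed_edges vs" and cd: "(c, d) \<in> directed_edges ws" and cr: "crossing N p (a, b) (c, d)"
    using c by (auto simp: crossings_def)
  have V: "a \<in> set vs" "b \<in> set vs" "c \<in> set ws" "d \<in> set ws"
    using ab cd directed_edges_vertices by blast+
  then have N: "a \<in> {1..N}" "b \<in> {1..N}" "c \<in> {1..N}" "d \<in> {1..N}"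
    using vs ws unfolding oriented_cycle_def by blast+
  have ne: "a \<noteq> b" "c \<noteq> d"
    using directed_edges_antisym(2) ab cd vs ws unfolding oriented_cycle_def by blast+
  have "{a, b} \<inter> {c, d} = {}" using V disj by blast
  then show "cyclic_between a b c \<noteq> cyclic_between a b d"
    and "cross (direction p (a, b)) (direction p (c, d)) \<noteq> 0"
    and "end_points (a, b) \<noteq> end_points (c, d)"
    using crossing_interleaves[OF p N(1,2) ne(1) N(3,4) _ cr] by (auto simp: end_points_def)
  have "{c, d} \<inter> {a, b} = {}" using V disj by blast
  then show "cyclic_between c d a \<noteq> cyclic_between c d b"
    using crossing_interleaves(1)[OF p N(3,4) ne(2) N(1,2) _ cr[THEN crossing_commute[THEN iffD2]]] by blast
qed

lemma linking_number_rev: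
  assumes p: "clockwise_on_circle N p" and e: "interior_enumeration N e"
    and cyc: "oriented_cycle N vs" "oriented_cycle N ws" "set vs \<inter> set ws = {}"
  shows "linking_number N p e \<sigma> (rev vs) ws = - linking_number N p e \<sigma> vs ws"
proof -
  have "crossings N p (rev vs) ws = (\<lambda>(d, d'). (prod.swap d, d')) ` crossings N p vs ws"
    unfolding crossings_def directed_edges_rev by (force simp: crossing_swap[of N p "(_, _)", simplified])
  moreover have "inj_on (\<lambda>(d, d'). (prod.swap d, d')) (crossings N p vs ws)"
    by (auto simp: inj_on_def)
  ultimately have "(\<Sum>(d, d')\<in>crossings N p (rev vs) ws. crossing_sign N p e \<sigma> d d')
      = (\<Sum>(d, d')\<in>crossings N p vs ws. crossing_sign N p e \<sigma> (prod.swap d) d')"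
    by (simp add: sum.reindex case_prod_unfold)
  also have "\<dots> = (\<Sum>(d, d')\<in>crossings N p vs ws. - crossing_sign N p e \<sigma> d d')"
  proof (intro sum.cong refl, clarify)
    fix a b c d assume c: "((a, b), (c, d)) \<in> crossings N p vs ws"
    note nz = crossings_of_disjoint_cycles(3)[OF p cyc c]
    have cr: "crossing N p (a, b) (c, d)" using c by (simp add: crossings_def)
    have neg: "cross (- z) w = - cross z w" for z w by (simp add: cross_def)
    show "crossing_sign N p e \<sigma> (prod.swap (a, b)) (c, d) = - crossing_sign N p e \<sigma> (a, b) (c, d)"
      using crossing_sign_eq[OF e cr nz] crossing_sign_eq[OF e, of p "prod.swap (a, b)" "(c, d)" \<sigma>] cr nz
      unfolding crossing_swap direction_swap edge_index_swap neg by (simp add: sgn_minus)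
  qed
  finally show ?thesis by (simp add: linking_number_eq case_prod_unfold sum_negf)
qed

lemma linking_number_commute:
  assumes p: "clockwise_on_circle N p" and e: "interior_enumeration N e" and \<sigma>: "inj \<sigma>"
    and cyc: "oriented_cycle N vs" "oriented_cycle N ws" "set vs \<inter> set ws = {}"
  shows "linking_number N p e \<sigma> ws vs = linking_number N p e \<sigma> vs ws"
proof -
  have "crossings N p ws vs = prod.swap ` crossings N p vs ws"
    unfolding crossings_def using crossing_commute by force
  then have "(\<Sum>(d, d')\<in>crossings N p ws vs. crossing_sign N p e \<sigma> d d')
      = (\<Sum>(d, d')\<in>crossings N p vs ws. crossing_sign N p e \<sigma> d' d)"
    by (simp add: sum.reindex case_prod_unfold)
  also have "\<dots> = (\<Sum>(d, d')\<in>crossings N p vs ws. crossing_sign N p e \<sigma> d d')"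
  proof (intro sum.cong refl, clarify)
    fix a b c d assume c: "((a, b), (c, d)) \<in> crossings N p vs ws"
    note nz = crossings_of_disjoint_cycles(3,4)[OF p cyc c]
    have cr: "crossing N p (a, b) (c, d)" using c by (simp add: crossings_def)
    then have "end_points (a, b) \<in> interior_edges N" "end_points (c, d) \<in> interior_edges N"
      by (auto simp: crossing_def)
    then have "edge_index N e (a, b) \<noteq> edge_index N e (c, d)"
      using edge_index(2)[OF e] nz(2) by metis
    then have "\<sigma> (edge_index N e (a, b)) \<noteq> \<sigma> (edge_index N e (c, d))" using \<sigma> by (auto dest: injD)
    from comparison_antisym[of \<sigma>, OF this]
    show "crossing_sign N p e \<sigma> (c, d) (a, b) = crossing_sign N p e \<sigma> (a, b) (c, d)"
      using crossing_sign_eq[OF e cr nz(1), of \<sigma>] nz(1)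
        crossing_sign_eq[OF e crossing_commute[THEN iffD2, OF cr], of \<sigma>]
        cross_commute[of "direction p (c, d)" "direction p (a, b)"]
      by (simp add: sgn_minus)
  qed
  finally show ?thesis by (simp add: linking_number_eq)
qed

lemma linking_number_sq_unoriented_left:
  assumes p: "clockwise_on_circle N p" and e: "interior_enumeration N e"
    and cyc: "oriented_cycle N vs" "oriented_cycle N ws" "set vs \<inter> set ws = {}"
    and vs': "oriented_cycle N vs'" "unoriented vs' = unoriented vs"
  shows "(linking_number N p e \<sigma> vs' ws)\<^sup>2 = (linking_number N p e \<sigma> vs ws)\<^sup>2"
proof -
  have "directed_edges vs' = directed_edges vs \<or> directed_edges vs' = directed_edges (rev vs)"
    using unoriented_eq_imp[of vs vs'] cyc(1) vs' by (auto simp: oriented_cycle_def directed_edges_rev)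
  then have "linking_number N p e \<sigma> vs' ws = linking_number N p e \<sigma> vs ws
      \<or> linking_number N p e \<sigma> vs' ws = linking_number N p e \<sigma> (rev vs) ws"
    unfolding linking_number_def by auto
  then show ?thesis using linking_number_rev[OF p e cyc] by auto
qed

text \<open>The choice operator in \<open>sq_linking\<close> may select different orientations, and a different order
of the two cycles, for every \<open>\<sigma>\<close>. All admissible choices give the same square, so the
increasing orientations can be used throughout.\<close>

lemma sq_linking_eq:
  assumes p: "clockwise_on_circle N p" and e: "interior_enumeration N e" and \<sigma>: "inj \<sigma>"
    and vs: "oriented_cycle N vs" and ws: "oriented_cycle N ws" and disj: "set vs \<inter> set ws = {}"
  shows "sq_linking N p e \<sigma> {unoriented vs, unoriented ws} = (linking_number N p e \<sigma> vs ws)\<^sup>2"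
proof -
  let ?l = "\<lambda>vs ws. (linking_number N p e \<sigma> vs ws)\<^sup>2"
  have same: "?l vs' ws' = ?l vs ws"
    if c: "oriented_cycle N vs" "oriented_cycle N ws" "set vs \<inter> set ws = {}"
      "oriented_cycle N vs'" "oriented_cycle N ws'"
      and u: "unoriented vs' = unoriented vs" "unoriented ws' = unoriented ws" for vs ws vs' ws'
  proof -
    have sets: "set vs' = set vs" "set ws' = set ws" using u Union_unoriented by metis+
    have "?l vs' ws' = ?l vs ws'"
      using c sets by (intro linking_number_sq_unoriented_left p e u) auto
    also have "\<dots> = ?l ws' vs"
      using linking_number_commute[OF p e \<sigma>, of vs ws'] c sets by simp
    also have "\<dots> = ?l ws vs"
      using c sets by (intro linking_number_sq_unoriented_left p e u) auto
    also have "\<dots> = ?l vs ws"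
      using linking_number_commute[OF p e \<sigma>, of vs ws] c by simp
    finally show ?thesis .
  qed
  show ?thesis unfolding sq_linking_def
  proof (rule some_equality)
    show "\<exists>vs' ws'. oriented_cycle N vs' \<and> oriented_cycle N ws' \<and>
        {unoriented vs, unoriented ws} = {unoriented vs', unoriented ws'} \<and> ?l vs ws = ?l vs' ws'"
      using vs ws by blast
  next
    fix x assume "\<exists>vs' ws'. oriented_cycle N vs' \<and> oriented_cycle N ws' \<and>
        {unoriented vs, unoriented ws} = {unoriented vs', unoriented ws'} \<and> x = ?l vs' ws'"
    then obtain vs' ws' where c: "oriented_cycle N vs'" "oriented_cycle N ws'" and x: "x = ?l vs' ws'"
      and "unoriented vs' = unoriented vs \<and> unoriented ws' = unoriented ws \<or>
        unoriented vs' = unoriented ws \<and> unoriented ws' = unoriented vs"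
      by (auto simp: doubleton_eq_iff)
    then show "x = ?l vs ws"
      using same[OF vs ws disj c] same[OF ws vs _ c] linking_number_commute[OF p e \<sigma> vs ws disj] disj
      by (auto simp: Int_commute)
  qed
qed

section \<open>Crossings between two increasing cycles\<close>

text \<open>If two edges of an increasing cycle start in an arc and leave it, then the one whose start comes
first would jump over the start of the other.\<close>

lemma exits_from_arc_unique:
  assumes "cyclic_between a b x1" "\<not> cyclic_between a b y1" "cyclic_between a b x2" "\<not> cyclic_between a b y2"
    and "\<not> cyclic_between x1 y1 x2" "\<not> cyclic_between x2 y2 x1"
  shows "x1 = x2"
  using assms unfolding cyclic_between_def by (simp split: if_splits)

lemma entries_to_arc_unique:
  assumes "cyclic_between a b y1" "\<not> cyclic_between a b x1" "cyclic_between a b y2" "\<not> cyclic_between a b x2"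
    and "\<not> cyclic_between x1 y1 y2" "\<not> cyclic_between x2 y2 y1"
  shows "y1 = y2"
  using assms unfolding cyclic_between_def by (simp split: if_splits)

text \<open>An increasing cycle passes through an arc only once, entering and leaving it by at most one
edge each. This is why the crossings form a graph of maximal degree \<open>2\<close>.\<close>

lemma card_edges_crossing_arc_le_2:
  assumes sorted: "sorted_wrt (<) vs"
  shows "card {(x, y) \<in> directed_edges vs. cyclic_between a b x \<noteq> cyclic_between a b y} \<le> 2"
proof -
  \<comment> \<open>Edges that leave the arc, and edges that enter it.\<close>
  let ?out = "{(x, y) \<in> directed_edges vs. cyclic_between a b x \<and> \<not> cyclic_between a b y}"
  let ?in = "{(x, y) \<in> directed_edges vs. cyclic_between a b y \<and> \<not> cyclic_between a b x}"
  have dist: "distinct vs" using sorted by (simp add: strict_sorted_iff)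
  note empty = sorted_directed_edge_empty_arc[OF sorted]
  note V = directed_edges_vertices
  have sub: "?out \<subseteq> directed_edges vs" "?in \<subseteq> directed_edges vs" by blast+
  note fin = finite_subset[OF sub(1) finite_directed_edges] finite_subset[OF sub(2) finite_directed_edges]
  have "card ?out \<le> Suc 0"
  proof -
    have "(x1, y1) = (x2, y2)" if "(x1, y1) \<in> ?out" "(x2, y2) \<in> ?out" for x1 y1 x2 y2
    proof -
      have d: "(x1, y1) \<in> directed_edges vs" "(x2, y2) \<in> directed_edges vs"
        and b: "cyclic_between a b x1" "\<not> cyclic_between a b y1" "cyclic_between a b x2" "\<not> cyclic_between a b y2"
        using that by simp_all
      have "x1 = x2"
        using empty[OF d(1), of x2] empty[OF d(2), of x1] V[OF d(1)] V[OF d(2)]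
        by (intro exits_from_arc_unique[OF b]) simp_all
      then show ?thesis using d directed_edges_unique_target[OF dist] by simp
    qed
    then have "c = d" if "c \<in> ?out" "d \<in> ?out" for c d
      using that by (cases c, cases d) (simp only:)
    then show ?thesis unfolding card_le_Suc0_iff_eq[OF fin(1)] by (intro ballI)
  qed
  moreover have "card ?in \<le> Suc 0"
  proof -
    have "(x1, y1) = (x2, y2)" if "(x1, y1) \<in> ?in" "(x2, y2) \<in> ?in" for x1 y1 x2 y2
    proof -
      have d: "(x1, y1) \<in> directed_edges vs" "(x2, y2) \<in> directed_edges vs"
        and b: "cyclic_between a b y1" "\<not> cyclic_between a b x1" "cyclic_between a b y2" "\<not> cyclic_between a b x2"
        using that by simp_all
      have "y1 = y2"
        using empty[OF d(1), of y2] empty[OF d(2), of y1] V[OF d(1)] V[OF d(2)]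
        by (intro entries_to_arc_unique[OF b]) simp_all
      then show ?thesis using d directed_edges_unique_source[OF dist] by simp
    qed
    then have "c = d" if "c \<in> ?in" "d \<in> ?in" for c d
      using that by (cases c, cases d) (simp only:)
    then show ?thesis unfolding card_le_Suc0_iff_eq[OF fin(2)] by (intro ballI)
  qed
  ultimately have "card (?out \<union> ?in) \<le> 2" using card_Un_le[of ?out ?in] by linarith
  moreover have "{(x, y) \<in> directed_edges vs. cyclic_between a b x \<noteq> cyclic_between a b y} = ?out \<union> ?in"
    by blast
  ultimately show ?thesis by (simp only:)
qed

lemma crossings_degree_le_2:
  assumes p: "clockwise_on_circle N p" and vs: "oriented_cycle N vs" "sorted_wrt (<) vs"
    and ws: "oriented_cycle N ws" "sorted_wrt (<) ws" and disj: "set vs \<inter> set ws = {}"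
  shows "card {c \<in> crossings N p vs ws. fst c = d} \<le> 2"
    and "card {c \<in> crossings N p vs ws. snd c = d} \<le> 2"
proof -
  obtain a b where d: "d = (a, b)" by fastforce
  note cr = crossings_of_disjoint_cycles[OF p vs(1) ws(1) disj]
  have "card {c \<in> crossings N p vs ws. fst c = d}
      \<le> card (Pair d ` {(x, y) \<in> directed_edges ws. cyclic_between a b x \<noteq> cyclic_between a b y})"
  proof (rule card_mono)
    show "finite (Pair d ` {(x, y) \<in> directed_edges ws. cyclic_between a b x \<noteq> cyclic_between a b y})"
      by (rule finite_imageI, rule finite_subset[OF _ finite_directed_edges[of ws]]) blast
    show "{c \<in> crossings N p vs ws. fst c = d}
        \<subseteq> Pair d ` {(x, y) \<in> directed_edges ws. cyclic_between a b x \<noteq> cyclic_between a b y}"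
    proof
      fix c assume "c \<in> {c \<in> crossings N p vs ws. fst c = d}"
      then obtain x y where c: "c = (d, (x, y))" "c \<in> crossings N p vs ws"
        by (cases c) auto
      then have "(x, y) \<in> directed_edges ws" "cyclic_between a b x \<noteq> cyclic_between a b y"
        using cr(1)[of a b x y] unfolding d by (auto simp: crossings_def)
      then show "c \<in> Pair d ` {(x, y) \<in> directed_edges ws. cyclic_between a b x \<noteq> cyclic_between a b y}"
        using c(1) by blast
    qed
  qed
  also have "\<dots> = card {(x, y) \<in> directed_edges ws. cyclic_between a b x \<noteq> cyclic_between a b y}"
    by (rule card_image) (auto simp: inj_on_def)
  also have "\<dots> \<le> 2" by (rule card_edges_crossing_arc_le_2[OF ws(2)])
  finally show "card {c \<in> crossings N p vs ws. fst c = d} \<le> 2" .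
  have "card {c \<in> crossings N p vs ws. snd c = d}
      \<le> card ((\<lambda>c. (c, d)) ` {(x, y) \<in> directed_edges vs. cyclic_between a b x \<noteq> cyclic_between a b y})"
  proof (rule card_mono)
    show "finite ((\<lambda>c. (c, d)) ` {(x, y) \<in> directed_edges vs. cyclic_between a b x \<noteq> cyclic_between a b y})"
      by (rule finite_imageI, rule finite_subset[OF _ finite_directed_edges[of vs]]) blast
    show "{c \<in> crossings N p vs ws. snd c = d}
        \<subseteq> (\<lambda>c. (c, d)) ` {(x, y) \<in> directed_edges vs. cyclic_between a b x \<noteq> cyclic_between a b y}"
    proof
      fix c assume "c \<in> {c \<in> crossings N p vs ws. snd c = d}"
      then obtain x y where c: "c = ((x, y), d)" "c \<in> crossings N p vs ws"
        by (cases c) auto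
      then have "(x, y) \<in> directed_edges vs" "cyclic_between a b x \<noteq> cyclic_between a b y"
        using cr(2)[of x y a b] unfolding d by (auto simp: crossings_def)
      then show "c \<in> (\<lambda>c. (c, d)) ` {(x, y) \<in> directed_edges vs. cyclic_between a b x \<noteq> cyclic_between a b y}"
        using c(1) by blast
    qed
  qed
  also have "\<dots> = card {(x, y) \<in> directed_edges vs. cyclic_between a b x \<noteq> cyclic_between a b y}"
    by (rule card_image) (auto simp: inj_on_def)
  also have "\<dots> \<le> 2" by (rule card_edges_crossing_arc_le_2[OF vs(2)])
  finally show "card {c \<in> crossings N p vs ws. snd c = d} \<le> 2" .
qed

lemma card_crossings_le:
  assumes "\<And>d. card {c \<in> crossings N p vs ws. fst c = d} \<le> 2"
  shows "card (crossings N p vs ws) \<le> 2 * length vs"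
proof -
  have "crossings N p vs ws = (\<Union>d\<in>directed_edges vs. {c \<in> crossings N p vs ws. fst c = d})"
    by (auto simp: crossings_def)
  then have "card (crossings N p vs ws) \<le> (\<Sum>d\<in>directed_edges vs. card {c \<in> crossings N p vs ws. fst c = d})"
    using card_UN_le[OF finite_directed_edges[of vs], of "\<lambda>d. {c \<in> crossings N p vs ws. fst c = d}"] by simp
  also have "\<dots> \<le> of_nat (card (directed_edges vs)) * 2"
    by (rule sum_bounded_above) (rule assms)
  also have "\<dots> \<le> 2 * length vs" using card_directed_edges_le[of vs] by simp
  finally show ?thesis .
qed

text \<open>The linking number is half a signed sum of comparisons over the crossings, whence the factor
\<open>4\<close> between these bounds and those of \<open>second_moment_comparisons\<close>.\<close>

lemma second_moment_linking_number:
  assumes p: "clockwise_on_circle N p" and e: "interior_enumeration N e"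
    and vs: "oriented_cycle N vs" "sorted_wrt (<) vs"
    and ws: "oriented_cycle N ws" "sorted_wrt (<) ws" and disj: "set vs \<inter> set ws = {}"
  defines "M \<equiv> (\<Sum>\<sigma> | \<sigma> permutes {1..num_interior N}. (linking_number N p e \<sigma> vs ws)\<^sup>2)"
  shows "real (card (crossings N p vs ws)) * fact (num_interior N) / 12 \<le> M"
    and "M \<le> 5 * real (card (crossings N p vs ws)) * fact (num_interior N) / 12"
proof -
  let ?C = "crossings N p vs ws"
  define w where "w c = sgn (cross (direction p (fst c)) (direction p (snd c)))" for c
  note cr = crossings_of_disjoint_cycles[OF p vs(1) ws(1) disj]
  have lk: "4 * (linking_number N p e \<sigma> vs ws)\<^sup>2
      = (\<Sum>c\<in>?C. w c * comparison \<sigma> (edge_index N e (fst c)) (edge_index N e (snd c)))\<^sup>2" for \<sigma>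
  proof -
    have "(\<Sum>(d, d')\<in>?C. crossing_sign N p e \<sigma> d d')
        = (\<Sum>c\<in>?C. w c * comparison \<sigma> (edge_index N e (fst c)) (edge_index N e (snd c)))"
    proof (rule sum.cong[OF refl], clarify)
      fix a b c d assume c: "((a, b), (c, d)) \<in> ?C"
      then have "crossing N p (a, b) (c, d)" by (simp add: crossings_def)
      from crossing_sign_eq[OF e this cr(3)[OF c]]
      show "crossing_sign N p e \<sigma> (a, b) (c, d) = w ((a, b), (c, d))
          * comparison \<sigma> (edge_index N e (fst ((a, b), (c, d)))) (edge_index N e (snd ((a, b), (c, d))))"
        unfolding w_def fst_conv snd_conv .
    qed
    then show ?thesis by (simp add: linking_number_eq power_divide)
  qed
  have interior: "end_points d \<in> interior_edges N" if "d \<in> fst ` ?C \<union> snd ` ?C" for d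
    using that by (auto simp: crossings_def crossing_def)
  have edges: "fst ` ?C \<subseteq> directed_edges vs" "snd ` ?C \<subseteq> directed_edges ws"
    by (auto simp: crossings_def)
  have inj: "inj_on (edge_index N e) (fst ` ?C \<union> snd ` ?C)"
  proof (rule inj_onI)
    fix d d' assume d: "d \<in> fst ` ?C \<union> snd ` ?C" "d' \<in> fst ` ?C \<union> snd ` ?C"
      and "edge_index N e d = edge_index N e d'"
    then have "end_points d = end_points d'"
      using edge_index(2)[OF e interior] by metis
    then have or: "d' = d \<or> d' = prod.swap d" by (simp add: end_points_eq_iff)
    obtain x y where xy: "d = (x, y)" by fastforce
    have "d \<in> directed_edges vs \<union> directed_edges ws" "d' \<in> directed_edges vs \<union> directed_edges ws"
      using d edges by blast+
    moreover have "(y, x) \<notin> directed_edges vs \<union> directed_edges ws" if "(x, y) \<in> directed_edges vs"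
      using that directed_edges_antisym(1)[OF _ _ that] directed_edges_vertices[OF that]
        directed_edges_vertices[of y x ws] disj vs(1) by (auto simp: oriented_cycle_def)
    moreover have "(y, x) \<notin> directed_edges vs \<union> directed_edges ws" if "(x, y) \<in> directed_edges ws"
      using that directed_edges_antisym(1)[OF _ _ that] directed_edges_vertices[OF that]
        directed_edges_vertices[of y x vs] disj ws(1) by (auto simp: oriented_cycle_def)
    ultimately have "d' \<noteq> prod.swap d" unfolding xy swap_simp by blast
    then show "d = d'" using or by simp
  qed
  have range: "edge_index N e ` (fst ` ?C \<union> snd ` ?C) \<subseteq> {1..num_interior N}"
    using edge_index(1)[OF e interior] by blast
  have bip: "fst ` ?C \<inter> snd ` ?C = {}"
  proof -
    have "d \<notin> directed_edges ws" if "d \<in> directed_edges vs" for d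
      using that directed_edges_vertices[of "fst d" "snd d"] disj by (cases d) (auto)
    then show ?thesis using edges by blast
  qed
  have weight: "\<bar>w c\<bar> = 1" if "c \<in> ?C" for c
  proof -
    obtain x y z t where c: "c = ((x, y), (z, t))" by (metis surj_pair)
    have "cross (direction p (x, y)) (direction p (z, t)) \<noteq> 0"
      by (rule cr(3)) (use that c in simp)
    then show ?thesis by (simp add: w_def c sgn_real_def)
  qed
  note bounds = second_moment_comparisons[OF finite_atLeastAtMost[of 1 "num_interior N"] finite_crossings inj range bip, of w,
      OF weight crossings_degree_le_2[OF p vs ws disj], folded lk]
  have "real (card ?C) * fact (num_interior N) / 3 \<le> 4 * M"
    by (rule bounds(1)[unfolded sum_distrib_left[symmetric] card_atLeastAtMost diff_Suc_1, folded M_def])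
  then show "real (card ?C) * fact (num_interior N) / 12 \<le> M" by linarith
  have "4 * M \<le> 5 * real (card ?C) * fact (num_interior N) / 3"
    by (rule bounds(2)[unfolded sum_distrib_left[symmetric] card_atLeastAtMost diff_Suc_1, folded M_def])
  then show "M \<le> 5 * real (card ?C) * fact (num_interior N) / 12" by linarith
qed

section \<open>Counting alternations\<close>

lemma card_sets_between:
  fixes V T U :: "'a set"
  assumes V: "finite V" and T: "T \<subseteq> V" and U: "U \<subseteq> V" and TU: "T \<inter> U = {}" and k: "card T \<le> k"
  shows "card {A. A \<subseteq> V \<and> card A = k \<and> T \<subseteq> A \<and> A \<inter> U = {}}
    = (card V - card T - card U) choose (k - card T)"
proof -
  have fin: "finite T" "finite U" using V T U finite_subset by blast+
  let ?W = "V - T - U"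
  have cardT: "card (X \<union> T) = card X + card T" if "X \<subseteq> ?W" for X
    using that V fin by (intro card_Un_disjoint) (auto intro: finite_subset)
  have "{A. A \<subseteq> V \<and> card A = k \<and> T \<subseteq> A \<and> A \<inter> U = {}}
      = (\<lambda>X. X \<union> T) ` {X. X \<subseteq> ?W \<and> card X = k - card T}"
  proof (intro equalityI subsetI)
    fix A assume A: "A \<in> {A. A \<subseteq> V \<and> card A = k \<and> T \<subseteq> A \<and> A \<inter> U = {}}"
    then have "A = (A - T) \<union> T" "A - T \<subseteq> ?W" "card (A - T) = k - card T"
      using fin by (auto simp: card_Diff_subset)
    then show "A \<in> (\<lambda>X. X \<union> T) ` {X. X \<subseteq> ?W \<and> card X = k - card T}" by blast
  next
    fix A assume "A \<in> (\<lambda>X. X \<union> T) ` {X. X \<subseteq> ?W \<and> card X = k - card T}"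
    then obtain X where X: "A = X \<union> T" "X \<subseteq> ?W" "card X = k - card T" by auto
    then show "A \<in> {A. A \<subseteq> V \<and> card A = k \<and> T \<subseteq> A \<and> A \<inter> U = {}}"
      using cardT[OF X(2)] k T TU by auto
  qed
  moreover have "inj_on (\<lambda>X. X \<union> T) {X. X \<subseteq> ?W \<and> card X = k - card T}"
    by (rule inj_onI) blast
  moreover have "card ?W = card V - card T - card U"
  proof -
    have "U \<subseteq> V - T" using U TU by blast
    then show ?thesis using T fin by (simp add: card_Diff_subset)
  qed
  ultimately show ?thesis using V by (simp add: card_image n_subsets)
qed

lemma card_half_sets:
  assumes "n \<ge> 1"
  shows "card (half_sets n) = (2 * n - 1) choose (n - 1)"
proof -
  have "half_sets n = {A. A \<subseteq> {1..2 * n} \<and> card A = n \<and> {1} \<subseteq> A \<and> A \<inter> {} = {}}"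
    by (auto simp: half_sets_def)
  then show ?thesis using card_sets_between[of "{1..2 * n}" "{1}" "{}" n] assms by simp
qed

lemma finite_half_sets [simp]: "finite (half_sets n)"
  by (rule finite_subset[of _ "Pow {1..2 * n}"]) (auto simp: half_sets_def)

text \<open>Places where four consecutive vertices belong in turn to \<open>A\<close>, to its complement, to \<open>A\<close> and to
its complement. Starting at \<open>2\<close> keeps the vertex \<open>1\<close>, which always lies in \<open>A\<close>, out of
the way, so that all places are equally likely.\<close>

definition alternations :: "nat \<Rightarrow> nat set \<Rightarrow> nat set" where
  "alternations n A = {j \<in> {2..2 * n - 3}. j \<in> A \<and> j + 1 \<notin> A \<and> j + 2 \<in> A \<and> j + 3 \<notin> A}"

lemma card_half_sets_alternating:
  assumes "n \<ge> 3" "j \<in> {2..2 * n - 3}"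
  shows "card {A \<in> half_sets n. j \<in> alternations n A} = (2 * n - 5) choose (n - 3)"
proof -
  have "{A \<in> half_sets n. j \<in> alternations n A}
      = {A. A \<subseteq> {1..2 * n} \<and> card A = n \<and> {1, j, j + 2} \<subseteq> A \<and> A \<inter> {j + 1, j + 3} = {}}"
    using assms by (auto simp: half_sets_def alternations_def)
  moreover have "card {1, j, j + 2} = 3" "card {j + 1, j + 3} = 2" using assms by auto
  moreover have "{1, j, j + 2} \<subseteq> {1..2 * n}" "{j + 1, j + 3} \<subseteq> {1..2 * n}"
    using assms by auto
  moreover have "{1, j, j + 2} \<inter> {j + 1, j + 3} = {}" using assms by auto
  moreover have "2 * n - 3 - 2 = 2 * n - (5 :: nat)" by simp
  ultimately show ?thesis
    using assms(1) card_sets_between[of "{1..2 * n}" "{1, j, j + 2}" "{j + 1, j + 3}" n]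
    by (simp only: finite_atLeastAtMost card_atLeastAtMost diff_Suc_1)
qed

text \<open>By Pascal's rule a binomial coefficient is at most twice the largest one of the row above.\<close>

lemma binomial_add4_le: "(m + 4) choose k \<le> 16 * (m choose (m div 2))"
proof -
  have step: "Suc m choose k \<le> 2 * c" if "\<And>k. m choose k \<le> c" for m k c
    using that[of k] that[of "k - 1"] that[of 0] by (cases k) (auto intro: order_trans)
  have "m choose k \<le> m choose (m div 2)" for k by (rule binomial_maximum)
  then have "Suc (Suc (Suc (Suc m))) choose k \<le> 2 * (2 * (2 * (2 * (m choose (m div 2)))))"
    by (intro step)
  then show ?thesis by (simp add: numeral_eq_Suc)
qed

text \<open>A given place is an alternation for at least one set in \<open>16\<close>: four memberships are prescribed,
and the sets that satisfy them are counted by a central binomial coefficient. Summing over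
the places gives a mean number of alternations that is linear in \<open>n\<close>.\<close>

lemma sum_card_alternations:
  assumes "n \<ge> 3"
  shows "real (2 * n - 4) * real (card (half_sets n)) \<le> 16 * (\<Sum>A\<in>half_sets n. real (card (alternations n A)))"
proof -
  have "(\<Sum>A\<in>half_sets n. card (alternations n A))
      = (\<Sum>A\<in>half_sets n. card {j \<in> {2..2 * n - 3}. j \<in> alternations n A})"
    by (intro sum.cong refl arg_cong[of _ _ card]) (auto simp: alternations_def)
  also have "\<dots> = (\<Sum>j\<in>{2..2 * n - 3}. card {A \<in> half_sets n. j \<in> alternations n A})"
    by (rule sum_multicount_gen) auto
  also have "\<dots> = (2 * n - 4) * ((2 * n - 5) choose (n - 3))"
    using card_half_sets_alternating[OF assms] assms by simp
  finally have sum: "(\<Sum>A\<in>half_sets n. card (alternations n A)) = (2 * n - 4) * ((2 * n - 5) choose (n - 3))" .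
  have "(2 * n - 5) div 2 = n - 3" "2 * n - 5 + 4 = 2 * n - 1" using assms by auto
  then have "card (half_sets n) \<le> 16 * ((2 * n - 5) choose (n - 3))"
    using binomial_add4_le[of "2 * n - 5" "n - 1"] card_half_sets[of n] assms by simp
  then have "(2 * n - 4) * card (half_sets n) \<le> 16 * (\<Sum>A\<in>half_sets n. card (alternations n A))"
    unfolding sum by (metis mult.left_commute mult_le_mono2)
  then show ?thesis by (metis (mono_tags) of_nat_mono of_nat_mult of_nat_numeral of_nat_sum)
qed

lemma card_alternations_le_crossings:
  assumes p: "clockwise_on_circle (2 * n) p" and A: "A \<subseteq> {1..2 * n}"
  shows "card (alternations n A) \<le> card (crossings (2 * n) p (increasing_cycle A) (increasing_cycle ({1..2 * n} - A)))"
proof (rule card_inj_on_le)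
  let ?f = "\<lambda>j. ((j, j + 2), (j + 1, j + 3))"
  show "inj_on ?f (alternations n A)" by (auto simp: inj_on_def)
  show "?f ` alternations n A \<subseteq> crossings (2 * n) p (increasing_cycle A) (increasing_cycle ({1..2 * n} - A))"
  proof (rule image_subsetI)
    fix j assume "j \<in> alternations n A"
    then have j: "j \<ge> 2" "j + 3 \<le> 2 * n" "j \<in> A" "j + 1 \<notin> A" "j + 2 \<in> A" "j + 3 \<notin> A"
      by (auto simp: alternations_def)
    have fin: "finite A" using A finite_subset by blast
    have "(j, j + 2) \<in> directed_edges (increasing_cycle A)"
    proof (rule sorted_consecutive_directed_edge)
      fix z assume "z \<in> set (increasing_cycle A)"
      then have "z \<noteq> j + 1" using j fin by auto
      then show "\<not> (j < z \<and> z < j + 2)" by linarith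
    qed (use j fin in auto)
    moreover have "(j + 1, j + 3) \<in> directed_edges (increasing_cycle ({1..2 * n} - A))"
    proof (rule sorted_consecutive_directed_edge)
      fix z assume "z \<in> set (increasing_cycle ({1..2 * n} - A))"
      then have "z \<noteq> j + 2" using j by auto
      then show "\<not> (j + 1 < z \<and> z < j + 3)" by linarith
    qed (use j in auto)
    ultimately show "?f j \<in> crossings (2 * n) p (increasing_cycle A) (increasing_cycle ({1..2 * n} - A))"
      using crossing_skips[OF p, of j] j by (simp add: crossings_def)
  qed
qed simp

section \<open>The mean squared linking number\<close>

lemma second_moment_half_set:
  assumes n: "n \<ge> 3" and p: "clockwise_on_circle (2 * n) p" and e: "interior_enumeration (2 * n) e"
    and A: "A \<in> half_sets n"
  defines "M \<equiv> (\<Sum>\<sigma> | \<sigma> permutes {1..num_interior (2 * n)}. sq_linking (2 * n) p e \<sigma> (cycle_pair n A))"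
  shows "real (card (alternations n A)) * fact (num_interior (2 * n)) / 12 \<le> M"
    and "M \<le> 5 / 6 * real n * fact (num_interior (2 * n))"
proof -
  let ?vs = "increasing_cycle A" and ?ws = "increasing_cycle ({1..2 * n} - A)"
  let ?C = "crossings (2 * n) p ?vs ?ws"
  have A': "A \<subseteq> {1..2 * n}" "card A = n" "finite A"
    using A finite_subset by (auto simp: half_sets_def)
  have vs: "oriented_cycle (2 * n) ?vs" using A' n by (auto simp: oriented_cycle_def)
  have ws: "oriented_cycle (2 * n) ?ws"
    using A' n by (auto simp: oriented_cycle_def card_Diff_subset)
  have disj: "set ?vs \<inter> set ?ws = {}" using A' by auto
  have srt: "sorted_wrt (<) ?vs" "sorted_wrt (<) ?ws" by simp_all
  have M: "M = (\<Sum>\<sigma> | \<sigma> permutes {1..num_interior (2 * n)}. (linking_number (2 * n) p e \<sigma> ?vs ?ws)\<^sup>2)"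
    unfolding M_def cycle_pair_def
    by (intro sum.cong refl sq_linking_eq p e vs ws disj) (auto dest: permutes_inj)
  note bounds = second_moment_linking_number[OF p e vs srt(1) ws srt(2) disj, folded M]
  have "real (card (alternations n A)) * fact (num_interior (2 * n)) / 12
      \<le> real (card ?C) * fact (num_interior (2 * n)) / 12"
    using card_alternations_le_crossings[OF p A'(1)] by (intro divide_right_mono mult_right_mono) auto
  then show "real (card (alternations n A)) * fact (num_interior (2 * n)) / 12 \<le> M"
    using bounds(1) by linarith
  have "card ?C \<le> 2 * length ?vs"
    using crossings_degree_le_2(1)[OF p vs srt(1) ws srt(2) disj] by (rule card_crossings_le)
  then have "real (card ?C) \<le> 2 * real n" using A' by simp
  then have upper: "5 * real (card ?C) * fact (num_interior (2 * n)) / 12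
      \<le> 5 * (2 * real n) * fact (num_interior (2 * n)) / 12"
    by (intro divide_right_mono mult_right_mono mult_left_mono) auto
  from order_trans[OF bounds(2) upper] show "M \<le> 5 / 6 * real n * fact (num_interior (2 * n))"
    by (simp only: mult_ac)
qed

lemma expectation_pair_pmf_of_set:
  fixes f :: "'a \<times> 'b \<Rightarrow> real"
  assumes "finite X" "X \<noteq> {}" "finite Y" "Y \<noteq> {}"
  shows "measure_pmf.expectation (pair_pmf (pmf_of_set X) (pmf_of_set Y)) f
    = (\<Sum>x\<in>X. \<Sum>y\<in>Y. f (x, y)) / (real (card X) * real (card Y))"
proof -
  have "measure_pmf.expectation (pair_pmf (pmf_of_set X) (pmf_of_set Y)) f
      = (\<Sum>z\<in>X \<times> Y. pmf (pair_pmf (pmf_of_set X) (pmf_of_set Y)) z *\<^sub>R f z)"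
    using assms by (intro integral_measure_pmf) auto
  also have "\<dots> = (\<Sum>z\<in>X \<times> Y. f z / (real (card X) * real (card Y)))"
    using assms by (intro sum.cong refl) (auto simp: pmf_pair pmf_of_set[OF assms(2,1)] pmf_of_set[OF assms(4,3)])
  finally show ?thesis by (simp add: sum_divide_distrib sum.cartesian_product)
qed

lemma mean_sq_linking_eq:
  assumes "n \<ge> 3"
  shows "mean_sq_linking n p e =
    (\<Sum>A\<in>half_sets n. \<Sum>\<sigma> | \<sigma> permutes {1..num_interior (2 * n)}. sq_linking (2 * n) p e \<sigma> (cycle_pair n A))
      / (real (card (half_sets n)) * fact (num_interior (2 * n)))"
proof -
  have "card (half_sets n) > 0" using card_half_sets[of n] assms by simp
  then have ne: "half_sets n \<noteq> {}" by auto
  have perms: "finite {\<sigma>. \<sigma> permutes {1..num_interior (2 * n)}}"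
    by (simp add: finite_permutations)
  have perms_ne: "{\<sigma>. \<sigma> permutes {1..num_interior (2 * n)}} \<noteq> {}"
    using permutes_id[of "{1..num_interior (2 * n)}"] by blast
  show ?thesis
    unfolding mean_sq_linking_def random_permutation_def disjoint_monotonic_pairs_eq[OF assms]
    using ne perms perms_ne
    by (simp add: expectation_pair_pmf_of_set card_image inj_on_cycle_pair sum.reindex card_permutations)
qed

text \<open>The constants are \<open>1/192 = 1/16 * 1/12\<close>, from the density of alternations and the contribution of
a crossing, and \<open>5/6 = 5/12 * 2\<close>, from the contribution of a crossing and the at most \<open>2n\<close>
crossings. The condition \<open>n > 3\<close> ensures \<open>2n - 4 \<ge> n\<close>.\<close>

theorem theorem11:
  "\<exists>(a::real) (A::real) (N::nat). a > 0 \<and> A > 0 \<and> N > 0 \<and>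
     (\<forall>(n::nat) (p :: nat \<Rightarrow> complex) (e :: nat \<Rightarrow> nat set).
        n \<ge> 3 \<and> n > N \<and> clockwise_on_circle (2 * n) p \<and> interior_enumeration (2 * n) e \<longrightarrow>
        a * real n \<le> mean_sq_linking n p e \<and> mean_sq_linking n p e \<le> A * real n)"
proof (rule exI[of _ "1 / 192"], rule exI[of _ "5 / 6"], rule exI[of _ 3], intro conjI allI impI)
  fix n :: nat and p e
  assume "n \<ge> 3 \<and> n > 3 \<and> clockwise_on_circle (2 * n) p \<and> interior_enumeration (2 * n) e"
  then have n: "n \<ge> 4" "n \<ge> 3" and p: "clockwise_on_circle (2 * n) p" and e: "interior_enumeration (2 * n) e"
    by auto
  define F :: real where "F = fact (num_interior (2 * n))"
  define H where "H = real (card (half_sets n))"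
  define T where "T = (\<Sum>A\<in>half_sets n. \<Sum>\<sigma> | \<sigma> permutes {1..num_interior (2 * n)}.
    sq_linking (2 * n) p e \<sigma> (cycle_pair n A))"
  have pos: "F > 0" "H > 0" using card_half_sets[of n] n by (simp_all add: F_def H_def)
  have mean: "mean_sq_linking n p e = T / (H * F)"
    unfolding mean_sq_linking_eq[OF n(2)] T_def H_def F_def ..
  have "T \<le> (\<Sum>A\<in>half_sets n. 5 / 6 * real n * F)"
    unfolding T_def F_def by (intro sum_mono second_moment_half_set n p e)
  then have "T \<le> 5 / 6 * real n * (H * F)" by (simp add: H_def mult_ac)
  then show "mean_sq_linking n p e \<le> 5 / 6 * real n"
    unfolding mean using pos by (simp add: pos_divide_le_eq)
  have "real n * H \<le> real (2 * n - 4) * H" using n pos by (intro mult_right_mono) auto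
  also have "\<dots> \<le> 16 * (\<Sum>A\<in>half_sets n. real (card (alternations n A)))"
    unfolding H_def by (rule sum_card_alternations[OF n(2)])
  finally have "real n * H * (F / 192) \<le> 16 * (\<Sum>A\<in>half_sets n. real (card (alternations n A))) * (F / 192)"
    using pos by (intro mult_right_mono) auto
  also have "\<dots> = (\<Sum>A\<in>half_sets n. real (card (alternations n A)) * F / 12)"
    by (simp add: sum_distrib_left mult_ac flip: sum_divide_distrib)
  also have "\<dots> \<le> T"
    unfolding T_def F_def by (intro sum_mono second_moment_half_set n p e)
  finally have "1 / 192 * real n * (H * F) \<le> T" by (simp add: mult_ac)
  then show "1 / 192 * real n \<le> mean_sq_linking n p e"
    unfolding mean using pos by (simp add: pos_le_divide_eq)
qed simp_all

end
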